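(* (In $\mathrm{ZF}$.) $\mathrm{6RC_{fin}}$ implies $\mathrm{6C^-_{fin}}$.
   Context: The base theory is $\mathrm{ZF}$ (no Axiom of Choice). For a set $x$ and $n\in\omega$, $[x]^n$ is the set of all $n$-element subsets of $x$ and $[x]^{>n}$ is the set of all finite subsets of $x$ with more than $n$ elements. $\mathrm{nRC_{fin}}$: given any infinite set $x$, there exist an infinite subset $y\subseteq x$ and a function $f\colon[y]^{>n}\to[y]^n$ such that $f(z)\subseteq z$ for all $z\in[y]^{>n}$. $\mathrm{nC^-_{fin}}$: given any infinite family $\mathcal F$ of finite sets of cardinality greater than $n$, there exist an infinite subfamily $\mathcal A\subseteq\mathcal F$ and a function $f\colon\mathcal A\to[\bigcup\mathcal A]^n$ such that $f(A)\subseteq A$ for all $A\in\mathcal A$. *)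

theory Defs
  imports Main
begin

text \<open>
  HOL proves the axiom of choice, so a statement about choice principles over ZF cannot be read
  as a statement about HOL sets. It is read in an arbitrary model of first-order ZF:
  a type with a binary relation \<open>mem\<close> (\<open>mem u x\<close> means ``\<open>u\<close> is an element of \<open>x\<close>'').
  The relation need not be well-founded from outside, and \<open>\<omega>\<close> of the model may be nonstandard.
  Functions, bijections and natural numbers below are always elements of the model.
\<close>

datatype fm =
    Mem nat nat
  | Eq nat nat
  | Neg fm
  | Conj fm fm
  | All nat fm

locale set_structure =
  fixes mem :: "'a \<Rightarrow> 'a \<Rightarrow> bool"
begin

primrec sat :: "(nat \<Rightarrow> 'a) \<Rightarrow> fm \<Rightarrow> bool" where
  "sat e (Mem i j) \<longleftrightarrow> mem (e i) (e j)"
| "sat e (Eq i j) \<longleftrightarrow> e i = e j"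
| "sat e (Neg p) \<longleftrightarrow> \<not> sat e p"
| "sat e (Conj p q) \<longleftrightarrow> sat e p \<and> sat e q"
| "sat e (All i p) \<longleftrightarrow> (\<forall>a. sat (e(i := a)) p)"

text \<open>
  The HOL set \<open>elts x\<close> only abbreviates formulas: every definition below unfolds to a first-order
  formula over \<open>mem\<close> whose quantifiers range over elements of the model.
\<close>

definition elts :: "'a \<Rightarrow> 'a set" where
  "elts x = {u. mem u x}"

definition is_succ :: "'a \<Rightarrow> 'a \<Rightarrow> bool" where
  "is_succ x s \<longleftrightarrow> elts s = insert x (elts x)"

definition is_inductive :: "'a \<Rightarrow> bool" where
  "is_inductive w \<longleftrightarrow>
     (\<exists>z\<in>elts w. elts z = {}) \<and> (\<forall>x\<in>elts w. \<exists>s\<in>elts w. is_succ x s)"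

text \<open>Membership in \<open>\<omega>\<close>, the least inductive set of the model.\<close>

definition is_nat :: "'a \<Rightarrow> bool" where
  "is_nat m \<longleftrightarrow> (\<forall>w. is_inductive w \<longrightarrow> m \<in> elts w)"

text \<open>The element of the model that is the von Neumann numeral of the standard number \<open>k\<close>.\<close>

primrec is_numeral :: "nat \<Rightarrow> 'a \<Rightarrow> bool" where
  "is_numeral 0 x \<longleftrightarrow> elts x = {}"
| "is_numeral (Suc k) x \<longleftrightarrow> (\<exists>y. is_numeral k y \<and> is_succ y x)"

text \<open>Kuratowski pairs.\<close>

definition is_pair :: "'a \<Rightarrow> 'a \<Rightarrow> 'a \<Rightarrow> bool" where
  "is_pair a b p \<longleftrightarrow> (\<exists>s t. elts s = {a} \<and> elts t = {a, b} \<and> elts p = {s, t})"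

definition maps_to :: "'a \<Rightarrow> 'a \<Rightarrow> 'a \<Rightarrow> bool" where
  "maps_to f a b \<longleftrightarrow> (\<exists>p\<in>elts f. is_pair a b p)"

definition is_function :: "'a \<Rightarrow> 'a \<Rightarrow> 'a \<Rightarrow> bool" where
  "is_function f X Y \<longleftrightarrow>
     (\<forall>p\<in>elts f. \<exists>a\<in>elts X. \<exists>b\<in>elts Y. is_pair a b p) \<and>
     (\<forall>a\<in>elts X. \<exists>!b. maps_to f a b)"

definition is_bijection :: "'a \<Rightarrow> 'a \<Rightarrow> 'a \<Rightarrow> bool" where
  "is_bijection f X Y \<longleftrightarrow> is_function f X Y \<and> (\<forall>b\<in>elts Y. \<exists>!a. maps_to f a b)"

definition equinumerous :: "'a \<Rightarrow> 'a \<Rightarrow> bool" where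
  "equinumerous X Y \<longleftrightarrow> (\<exists>f. is_bijection f X Y)"

definition is_finite :: "'a \<Rightarrow> bool" where
  "is_finite x \<longleftrightarrow> (\<exists>m. is_nat m \<and> equinumerous x m)"

text \<open>\<open>x\<close> is finite of cardinality greater than the natural number \<open>n\<close> of the model.\<close>

definition finite_card_gt :: "'a \<Rightarrow> 'a \<Rightarrow> bool" where
  "finite_card_gt n x \<longleftrightarrow> (\<exists>m. is_nat m \<and> n \<in> elts m \<and> equinumerous x m)"

text \<open>\<open>S = [x]\<^sup>n\<close> and \<open>S = [x]\<close> with exponent \<open>>n\<close>, respectively.\<close>

definition is_subsets_card :: "'a \<Rightarrow> 'a \<Rightarrow> 'a \<Rightarrow> bool" where
  "is_subsets_card n x S \<longleftrightarrow> elts S = {z. elts z \<subseteq> elts x \<and> equinumerous z n}"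

definition is_subsets_card_gt :: "'a \<Rightarrow> 'a \<Rightarrow> 'a \<Rightarrow> bool" where
  "is_subsets_card_gt n x S \<longleftrightarrow> elts S = {z. elts z \<subseteq> elts x \<and> finite_card_gt n z}"

definition is_union :: "'a \<Rightarrow> 'a \<Rightarrow> bool" where
  "is_union x U \<longleftrightarrow> elts U = (\<Union>y\<in>elts x. elts y)"

definition nRC_fin :: "'a \<Rightarrow> bool" where
  "nRC_fin n \<longleftrightarrow>
     (\<forall>x. \<not> is_finite x \<longrightarrow>
       (\<exists>y. elts y \<subseteq> elts x \<and> \<not> is_finite y \<and>
         (\<exists>D C f. is_subsets_card_gt n y D \<and> is_subsets_card n y C \<and> is_function f D C \<and>
           (\<forall>z\<in>elts D. \<forall>v. maps_to f z v \<longrightarrow> elts v \<subseteq> elts z))))"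

definition nC_minus_fin :: "'a \<Rightarrow> bool" where
  "nC_minus_fin n \<longleftrightarrow>
     (\<forall>F. \<not> is_finite F \<and> (\<forall>A\<in>elts F. finite_card_gt n A) \<longrightarrow>
       (\<exists>\<A>. elts \<A> \<subseteq> elts F \<and> \<not> is_finite \<A> \<and>
         (\<exists>U C f. is_union \<A> U \<and> is_subsets_card n U C \<and> is_function f \<A> C \<and>
           (\<forall>A\<in>elts \<A>. \<forall>v. maps_to f A v \<longrightarrow> elts v \<subseteq> elts A))))"

end

text \<open>
  The schemas of separation and replacement range over first-order formulas only, with parameters
  supplied by the assignment \<open>e\<close>. Ranging over all HOL predicates instead would transfer the axiom
  of choice from HOL into the model.
\<close>

locale ZF = set_structure mem for mem :: "'a \<Rightarrow> 'a \<Rightarrow> bool" +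
  assumes extensionality: "elts x = elts y \<Longrightarrow> x = y"
    and foundation: "elts x \<noteq> {} \<Longrightarrow> \<exists>y\<in>elts x. elts y \<inter> elts x = {}"
    and pairing: "\<exists>z. elts z = {x, y}"
    and union: "\<exists>U. is_union x U"
    and power_set: "\<exists>z. elts z = {y. elts y \<subseteq> elts x}"
    and infinity: "\<exists>w. is_inductive w"
    and separation: "\<exists>z. elts z = {u \<in> elts x. sat (e(0 := u)) p}"
    and replacement:
      "(\<And>u v v'. u \<in> elts x \<Longrightarrow> sat (e(0 := u, 1 := v)) p \<Longrightarrow> sat (e(0 := u, 1 := v')) p \<Longrightarrow> v = v')
       \<Longrightarrow> \<exists>z. elts z = {v. \<exists>u\<in>elts x. sat (e(0 := u, 1 := v)) p}"

end

theory Submission imports Defs begin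

text \<open>
  Let \<open>X\<close> be the set of all pairs of a member \<open>A\<close> of the family and an injective 7-tuple in \<open>A\<close>, grouped
  into classes by \<open>A\<close>. The hypothesis yields an infinite subset all of whose nonempty classes have at most
  six elements, and one of the least possible constant class size \<open>k\<close> is \<^emph>\<open>homogeneous\<close>: no infinite
  subset meets all its classes in proper parts. Fix a selection of six elements from every larger
  finite set of points.

  If \<open>k > 1\<close>, no relation on the classes can be total, definable and have finite forward neighbourhoods: it
  would give an infinite chain of finite sets of classes, and the hypothesis applied to selectors on the
  members of the chain would produce a choice of one point in infinitely many classes. By homogeneity,
  each class can split only finitely many others. If \<open>k\<close> is 4 or 5, selecting six elements of the union
  of two classes splits one of them, which is such a relation. If \<open>k = 6\<close> and the classes map onto sets
  of sizes 3 and 2, selecting six of seven suitable elements from two classes does the same.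

  Otherwise \<open>k\<close> divides 6, almost every class maps onto seven pairwise equal or disjoint subsets of
  \<open>A\<close> with sizes dividing \<open>k\<close>, their union has at least seven elements, and sizes 2 and 3 do not both
  occur; so the union of some of them has exactly six elements.
\<close>

section \<open>Definability in a model\<close>

text \<open>The delicate point is that block sizes must have a subsum of exactly six. Blocks 4+4,
  5+5 and the mixture 2+2+3 have none; these are the configurations to be excluded. Sizes 1 and d,
  with d = 2 or d = 3, always reach six once their total is at least seven. This explains the length
  of the tuples: the coordinates of one injective tuple already contribute seven points, and every
  member of the family has such a tuple. The members may overlap and have unbounded, even
  nonstandard, size. Tagging tuples with \<open>A\<close> makes the classes disjoint, and the
  selection cuts them down to a size that is known outside the model. The other obstacle is that
  choice holds in HOL. Every set that has to exist in the model, and every induction over its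
  natural numbers, must come from a definable predicate; choices made in HOL only serve to count or
  to name finitely many parameters.\<close>

primrec rename_fm :: "(nat \<Rightarrow> nat) \<Rightarrow> fm \<Rightarrow> fm" where
  "rename_fm \<pi> (Mem i j) = Mem (\<pi> i) (\<pi> j)"
| "rename_fm \<pi> (Eq i j) = Eq (\<pi> i) (\<pi> j)"
| "rename_fm \<pi> (Neg p) = Neg (rename_fm \<pi> p)"
| "rename_fm \<pi> (Conj p q) = Conj (rename_fm \<pi> p) (rename_fm \<pi> q)"
| "rename_fm \<pi> (All i p) = All (\<pi> i) (rename_fm \<pi> p)"

context set_structure
begin

text \<open>Injectivity prevents capture: updating the environment at \<open>\<pi> i\<close> changes
  the composite with \<open>\<pi>\<close> at \<open>i\<close> only, which is what the quantifier
  case requires.\<close>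

lemma sat_rename_fm: "inj \<pi> \<Longrightarrow> sat e (rename_fm \<pi> p) = sat (e \<circ> \<pi>) p"
proof (induction p arbitrary: e)
  case (All i p)
  have "e(\<pi> i := a) \<circ> \<pi> = (e \<circ> \<pi>)(i := a)" for a
    using All.prems by (auto simp: fun_eq_iff inj_eq)
  then show ?case using All by (simp del: fun_upd_apply add: comp_def)
qed auto

text \<open>
  Even positions carry the de Bruijn environment, odd positions the parameters, so that two
  formulas can be combined without running out of variables.
\<close>

definition mix :: "(nat \<Rightarrow> 'a) \<Rightarrow> (nat \<Rightarrow> 'a) \<Rightarrow> nat \<Rightarrow> 'a" where
  "mix e r n = (if even n then e (n div 2) else r (n div 2))"

text \<open>Closure properties of this predicate take the place of writing formulas by hand. The
  parameters \<open>r\<close> are chosen together with \<open>p\<close> and do not vary with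
  \<open>e\<close>, as in the schemas of separation and replacement.\<close>

definition definable :: "((nat \<Rightarrow> 'a) \<Rightarrow> bool) \<Rightarrow> bool" where
  "definable P \<longleftrightarrow> (\<exists>p r. \<forall>e. P e = sat (mix e r) p)"

definition definable_term :: "((nat \<Rightarrow> 'a) \<Rightarrow> 'a) \<Rightarrow> bool" where
  "definable_term t \<longleftrightarrow> definable (\<lambda>e. e 0 = t (\<lambda>n. e (Suc n)))"

lemma definable_I: "(\<And>e. P e = sat (mix e r) p) \<Longrightarrow> definable P"
  unfolding definable_def by blast

lemma definable_mem_var: "definable (\<lambda>e. mem (e i) (e j))"
  by (rule definable_I[where p="Mem (2*i) (2*j)"]) (simp add: mix_def)

lemma definable_eq_var: "definable (\<lambda>e. e i = e j)"
  by (rule definable_I[where p="Eq (2*i) (2*j)"]) (simp add: mix_def)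

lemma definable_eq_param: "definable (\<lambda>e. e i = c)"
  by (rule definable_I[where p="Eq (2*i) 1" and r="\<lambda>_. c"]) (simp add: mix_def)

named_theorems definable_intros

lemma definable_not [definable_intros]: assumes "definable P" shows "definable (\<lambda>e. \<not> P e)"
proof -
  obtain p r where "\<And>e. P e = sat (mix e r) p" using assms unfolding definable_def by blast
  then show ?thesis by (intro definable_I[where p="Neg p" and r=r]) simp
qed

lemma definable_conj [definable_intros]: assumes "definable P" "definable Q" shows "definable (\<lambda>e. P e \<and> Q e)"
proof -
  obtain p1 r1 where 1: "\<And>e. P e = sat (mix e r1) p1" using assms unfolding definable_def by blast
  obtain p2 r2 where 2: "\<And>e. Q e = sat (mix e r2) p2" using assms unfolding definable_def by blast
  \<comment> \<open>The two formulas come with unrelated parameter lists. The odd position 2b+1 is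
    sent to 4b+1 by \<open>\<pi>1\<close> and to 4b+3 by \<open>\<pi>2\<close>, so the lists can be
    interleaved in \<open>r\<close>.\<close>
  define \<pi>1 where "\<pi>1 n = (if even n then n else 2 * n - 1)" for n :: nat
  define \<pi>2 where "\<pi>2 n = (if even n then n else 2 * n + 1)" for n :: nat
  have i1: "inj \<pi>1" and i2: "inj \<pi>2"
    unfolding \<pi>1_def \<pi>2_def inj_def by (auto split: if_splits; presburger)+
  define r where "r n = (if even n then r1 (n div 2) else r2 (n div 2))" for n :: nat
  have "mix e r \<circ> \<pi>1 = mix e r1" for e
  proof (rule ext)
    fix n :: nat
    have "\<exists>b. n = 2 * b \<or> n = 2 * b + 1" by presburger
    then obtain b where "n = 2 * b \<or> n = 2 * b + 1" ..
    then show "(mix e r \<circ> \<pi>1) n = mix e r1 n"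
      by (auto simp: mix_def \<pi>1_def r_def)
  qed
  moreover have "mix e r \<circ> \<pi>2 = mix e r2" for e
  proof (rule ext)
    fix n :: nat
    have "\<exists>b. n = 2 * b \<or> n = 2 * b + 1" by presburger
    then obtain b where "n = 2 * b \<or> n = 2 * b + 1" ..
    then show "(mix e r \<circ> \<pi>2) n = mix e r2 n"
      by (auto simp: mix_def \<pi>2_def r_def)
  qed
  ultimately show ?thesis
    by (intro definable_I[where p="Conj (rename_fm \<pi>1 p1) (rename_fm \<pi>2 p2)" and r=r])
       (simp add: sat_rename_fm i1 i2 1 2)
qed

lemma definable_all [definable_intros]: assumes "definable (\<lambda>e. P (\<lambda>n. e (Suc n)) (e 0))" shows "definable (\<lambda>e. \<forall>a. P e a)"
proof -
  obtain p r where 1: "\<And>e. P (\<lambda>n. e (Suc n)) (e 0) = sat (mix e r) p"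
    using assms unfolding definable_def by blast
  \<comment> \<open>The bound variable moves from position 0 to the odd position 1, which is vacated
    by shifting all parameters up; the even positions shift down by one de Bruijn index.\<close>
  define \<pi> where "\<pi> n = (if n = 0 then 1 else if even n then n - 2 else n + 2)" for n :: nat
  have i: "inj \<pi>" unfolding \<pi>_def inj_def by (auto split: if_splits; presburger)
  define r' where "r' n = r (n - 1)" for n
  have "(mix e r')(1 := a) \<circ> \<pi> = mix (\<lambda>n. case n of 0 \<Rightarrow> a | Suc m \<Rightarrow> e m) r" for e a
    by (auto simp: fun_eq_iff mix_def \<pi>_def r'_def split: nat.splits elim!: oddE evenE)
  moreover have "P e a = sat (mix (\<lambda>n. case n of 0 \<Rightarrow> a | Suc m \<Rightarrow> e m) r) p" for e a
    using 1[of "\<lambda>n. case n of 0 \<Rightarrow> a | Suc m \<Rightarrow> e m"] by simp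
  ultimately show ?thesis
    by (intro definable_I[where p="All 1 (rename_fm \<pi> p)" and r=r'])
       (simp add: sat_rename_fm i)
qed

lemma definable_reindex: assumes "inj \<pi>" "definable P" shows "definable (\<lambda>e. P (\<lambda>n. e (\<pi> n)))"
proof -
  obtain p r where 1: "\<And>e. P e = sat (mix e r) p" using assms unfolding definable_def by blast
  define \<pi>' where "\<pi>' n = (if even n then 2 * \<pi> (n div 2) else n)" for n
  have i: "inj \<pi>'" unfolding \<pi>'_def inj_def
    by (auto split: if_splits elim!: evenE simp: inj_eq[OF assms(1)])
  have "mix e r \<circ> \<pi>' = mix (\<lambda>n. e (\<pi> n)) r" for e
    by (auto simp: fun_eq_iff mix_def \<pi>'_def)
  then show ?thesis
    by (intro definable_I[where p="rename_fm \<pi>' p" and r=r]) (simp add: sat_rename_fm i 1)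
qed

lemma definable_const [definable_intros]: "definable (\<lambda>e. B)"
proof (cases B)
  case True
  then show ?thesis by (intro definable_I[where p="Eq 0 0"]) simp
next
  case False
  then show ?thesis by (intro definable_I[where p="Neg (Eq 0 0)"]) simp
qed

lemma definable_disj [definable_intros]: "definable P \<Longrightarrow> definable Q \<Longrightarrow> definable (\<lambda>e. P e \<or> Q e)"
  using definable_not[OF definable_conj[OF definable_not definable_not]] by simp

lemma definable_imp [definable_intros]: "definable P \<Longrightarrow> definable Q \<Longrightarrow> definable (\<lambda>e. P e \<longrightarrow> Q e)"
  unfolding imp_conv_disj by (intro definable_disj definable_not)

lemma definable_iff: "definable P \<Longrightarrow> definable Q \<Longrightarrow> definable (\<lambda>e. P e \<longleftrightarrow> Q e)"
  unfolding iff_conv_conj_imp by (intro definable_conj definable_imp)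

lemma definable_ex [definable_intros]: "definable (\<lambda>e. P (\<lambda>n. e (Suc n)) (e 0)) \<Longrightarrow> definable (\<lambda>e. \<exists>a. P e a)"
  using definable_not[OF definable_all[OF definable_not]] by simp

section \<open>Definable terms and their substitution into predicates\<close>

lemma term_var [definable_intros]: "definable_term (\<lambda>e. e i)"
  unfolding definable_term_def by (rule definable_eq_var)

lemma term_param [definable_intros]: "definable_term (\<lambda>e. c)"
  unfolding definable_term_def by (rule definable_eq_param)

lemma term_shift: "definable_term t \<Longrightarrow> definable_term (\<lambda>e. t (\<lambda>n. e (Suc n)))"
  unfolding definable_term_def
  using definable_reindex[of "\<lambda>n. case n of 0 \<Rightarrow> 0 | Suc m \<Rightarrow> Suc (Suc m)" "\<lambda>e. e 0 = t (\<lambda>n. e (Suc n))"]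
  by (simp add: inj_def split: nat.splits)

text \<open>\<open>P e (t e)\<close> is read as the existence of some a with a = \<open>t e\<close>
  and \<open>P e a\<close>, so substitution requires no operation on formulas.\<close>

lemma definable_subst:
  assumes "definable (\<lambda>e. P (\<lambda>n. e (Suc n)) (e 0))" "definable_term t" shows "definable (\<lambda>e. P e (t e))"
proof -
  have "definable (\<lambda>e. \<exists>a. a = t e \<and> P e a)"
    using assms unfolding definable_term_def by (intro definable_ex definable_conj)
  then show ?thesis by simp
qed

lemma definable_lift1: assumes "\<And>i. definable (\<lambda>e. Q (e i))" "definable_term t" shows "definable (\<lambda>e. Q (t e))"
  by (rule definable_subst[where P="\<lambda>e a. Q a", OF assms])

lemma definable_lift2:
  assumes Q: "\<And>i j. definable (\<lambda>e. Q (e i) (e j))" and "definable_term t" "definable_term s"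
  shows "definable (\<lambda>e. Q (t e) (s e))"
proof -
  have "definable (\<lambda>e. Q (t' e) (e j))" if "definable_term t'" for t' j
    by (rule definable_subst[where P="\<lambda>e a. Q a (e j)", OF Q that])
  then show ?thesis
    by (rule definable_subst[where P="\<lambda>e a. Q (t e) a", OF _ \<open>definable_term s\<close>]) (rule term_shift[OF \<open>definable_term t\<close>])
qed

lemma definable_lift3:
  assumes Q: "\<And>i j k. definable (\<lambda>e. Q (e i) (e j) (e k))" and "definable_term t" "definable_term s" "definable_term u"
  shows "definable (\<lambda>e. Q (t e) (s e) (u e))"
proof -
  have "definable (\<lambda>e. Q (t' e) (s' e) (e k))" if "definable_term t'" "definable_term s'" for t' s' k
  proof -
    have "definable (\<lambda>e. Q (t'' e) (e j) (e k))" if "definable_term t''" for t'' j k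
      by (rule definable_subst[where P="\<lambda>e a. Q a (e j) (e k)", OF Q that])
    then show ?thesis
      by (rule definable_subst[where P="\<lambda>e a. Q (t' e) a (e k)", OF _ \<open>definable_term s'\<close>])
         (rule term_shift[OF \<open>definable_term t'\<close>])
  qed
  then show ?thesis
    by (rule definable_subst[where P="\<lambda>e a. Q (t e) (s e) a", OF _ \<open>definable_term u\<close>])
       (rule term_shift[OF \<open>definable_term t\<close>] term_shift[OF \<open>definable_term s\<close>])+
qed

lemma term_lift1: assumes g: "\<And>i. definable_term (\<lambda>e. g (e i))" and t: "definable_term t" shows "definable_term (\<lambda>e. g (t e))"
proof -
  have "definable (\<lambda>e. e i = g (e j))" for i j
    by (rule definable_subst[where P="\<lambda>e a. e i = a", OF definable_eq_var g])
  then show ?thesis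
    unfolding definable_term_def by (rule definable_lift2[where Q="\<lambda>x y. x = g y", OF _ term_var term_shift[OF t]])
qed

lemma term_lift2:
  assumes g: "\<And>i j. definable_term (\<lambda>e. g (e i) (e j))" and t: "definable_term t" "definable_term s"
  shows "definable_term (\<lambda>e. g (t e) (s e))"
proof -
  have "definable (\<lambda>e. e i = g (e j) (e k))" for i j k
    by (rule definable_subst[where P="\<lambda>e a. e i = a", OF definable_eq_var g])
  then show ?thesis
    unfolding definable_term_def
    by (rule definable_lift3[where Q="\<lambda>x y z. x = g y z", OF _ term_var term_shift[OF t(1)] term_shift[OF t(2)]])
qed

lemma definable_eq [definable_intros]: "definable_term t \<Longrightarrow> definable_term s \<Longrightarrow> definable (\<lambda>e. t e = s e)"
  by (rule definable_lift2[where Q="(=)", OF definable_eq_var])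

lemma definable_in [definable_intros]: "definable_term t \<Longrightarrow> definable_term s \<Longrightarrow> definable (\<lambda>e. t e \<in> elts (s e))"
  unfolding elts_def mem_Collect_eq by (rule definable_lift2[where Q="mem", OF definable_mem_var])

lemma definable_ball [definable_intros]:
  assumes "definable_term t" "definable (\<lambda>e. P (\<lambda>n. e (Suc n)) (e 0))" shows "definable (\<lambda>e. \<forall>a\<in>elts (t e). P e a)"
  unfolding Ball_def by (intro definable_intros assms term_shift)

lemma definable_bex [definable_intros]:
  assumes "definable_term t" "definable (\<lambda>e. P (\<lambda>n. e (Suc n)) (e 0))" shows "definable (\<lambda>e. \<exists>a\<in>elts (t e). P e a)"
  unfolding Bex_def by (intro definable_intros assms term_shift)

lemma definable_subset [definable_intros]:
  assumes "definable_term t" "definable_term s" shows "definable (\<lambda>e. elts (t e) \<subseteq> elts (s e))"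
  unfolding subset_iff by (intro definable_intros assms term_shift)

lemma definable_ball_finite:
  assumes "finite I" "\<And>i. i \<in> I \<Longrightarrow> definable (P i)" shows "definable (\<lambda>e. \<forall>i\<in>I. P i e)"
  using assms by (induction I rule: finite_induct) (auto intro!: definable_intros)

lemma definable_bex_finite:
  assumes "finite I" "\<And>i. i \<in> I \<Longrightarrow> definable (P i)" shows "definable (\<lambda>e. \<exists>i\<in>I. P i e)"
  using assms by (induction I rule: finite_induct) (auto intro!: definable_intros)

text \<open>Classes that are not sets are mapped to one fixed junk value.\<close>

definition small :: "'a set \<Rightarrow> bool" where
  "small S \<longleftrightarrow> (\<exists>z. elts z = S)"

definition the_elt_of :: "'a set \<Rightarrow> 'a" where
  "the_elt_of S = (THE z. elts z = S)"

end

section \<open>Basic set theory in the model\<close>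

context ZF
begin

lemma elts_inject [simp]: "elts x = elts y \<longleftrightarrow> x = y"
  using extensionality by blast

lemma the_elt_of_elts [simp]: "the_elt_of (elts z) = z"
  unfolding the_elt_of_def by simp

lemma elts_the_elt_of: "small S \<Longrightarrow> elts (the_elt_of S) = S"
  unfolding small_def by auto

lemma small_elts [simp]: "small (elts z)"
  unfolding small_def by blast

lemma smallE: assumes "small S" obtains z where "S = elts z"
  using assms unfolding small_def by blast

lemma term_the_elt_of [definable_intros]:
  assumes "definable (\<lambda>e. P (\<lambda>n. e (Suc n)) (e 0))" shows "definable_term (\<lambda>e. the_elt_of {u. P e u})"
proof -
  have P: "definable (\<lambda>e. P (\<lambda>n. e (Suc (Suc n))) (e 0))"
    using definable_reindex[OF _ assms, of "\<lambda>n. case n of 0 \<Rightarrow> 0 | Suc m \<Rightarrow> Suc (Suc m)"]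
    by (simp add: inj_def split: nat.splits)
  have P': "definable (\<lambda>e. P (\<lambda>n. e (Suc (Suc (Suc n)))) (e 0))"
    using definable_reindex[OF _ assms, of "\<lambda>n. case n of 0 \<Rightarrow> 0 | Suc m \<Rightarrow> Suc (Suc (Suc m))"]
    by (simp add: inj_def split: nat.splits)
  \<comment> \<open>The second disjunct treats classes that are not sets: there the junk value
    enters the formula as a parameter.\<close>
  have "e 0 = the_elt_of {u. P (\<lambda>n. e (Suc n)) u} \<longleftrightarrow>
      (\<forall>u. u \<in> elts (e 0) \<longleftrightarrow> P (\<lambda>n. e (Suc n)) u) \<or>
      \<not> (\<exists>z. \<forall>u. u \<in> elts z \<longleftrightarrow> P (\<lambda>n. e (Suc n)) u) \<and> e 0 = (THE z. False)" for e
  proof (cases "small {u. P (\<lambda>n. e (Suc n)) u}")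
    case True
    then obtain z where z: "elts z = {u. P (\<lambda>n. e (Suc n)) u}" unfolding small_def by blast
    have "(\<forall>u. u \<in> elts x \<longleftrightarrow> P (\<lambda>n. e (Suc n)) u) \<longleftrightarrow> x = z" for x
      using z by (metis mem_Collect_eq elts_inject set_eqI)
    then show ?thesis using z by (metis the_elt_of_elts)
  next
    case False
    then have "(\<lambda>z. elts z = {u. P (\<lambda>n. e (Suc n)) u}) = (\<lambda>z. False)"
      unfolding small_def by auto
    moreover have "\<not> (\<exists>z. \<forall>u. u \<in> elts z \<longleftrightarrow> P (\<lambda>n. e (Suc n)) u)"
      using False unfolding small_def by blast
    ultimately show ?thesis unfolding the_elt_of_def by auto
  qed
  then show ?thesis unfolding definable_term_def
    by (simp only:) (intro definable_intros definable_iff P P')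
qed

lemma small_subset:
  assumes "small S" "T \<subseteq> S" "definable (\<lambda>e. e 0 \<in> T)" shows "small T"
proof -
  obtain x where x: "S = elts x" using assms(1) by (rule smallE)
  obtain p r where p: "\<And>e. (e 0 \<in> T) = sat (mix e r) p"
    using assms(3) unfolding definable_def by blast
  have "(mix (\<lambda>_. x) r)(0 := u) = mix ((\<lambda>_. x)(0 := u)) r" for u
    by (auto simp: fun_eq_iff mix_def elim!: evenE)
  then have "sat ((mix (\<lambda>_. x) r)(0 := u)) p \<longleftrightarrow> u \<in> T" for u
    using p[of "(\<lambda>_. x)(0 := u)"] by simp
  then have "{u \<in> elts x. sat ((mix (\<lambda>_. x) r)(0 := u)) p} = T"
    using assms(2) x by auto
  then show ?thesis using separation[of x "mix (\<lambda>_. x) r" p] unfolding small_def by simp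
qed

lemma small_image:
  assumes "small S" "definable_term (\<lambda>e. g (e 0))" shows "small (g ` S)"
proof -
  obtain x where x: "S = elts x" using assms(1) by (rule smallE)
  obtain p r where p: "\<And>e. (e 0 = g (e 1)) = sat (mix e r) p"
    using assms(2) unfolding definable_term_def definable_def by auto
  \<comment> \<open>Replacement expects the argument in variable 0 and the value in variable 1,
    whereas \<open>p\<close> has the value at 0, its first parameter at 1 and the argument at 2. The
    cycle realigns the three, and \<open>e0\<close> stores the displaced parameter at 2.\<close>
  define \<pi> where "\<pi> n = (if n = 0 then 1 else if n = 1 then 2 else if n = 2 then 0 else n)" for n :: nat
  have i: "inj \<pi>" unfolding \<pi>_def inj_def by auto
  define e0 where "e0 n = (if n = 2 then r 0 else mix (\<lambda>_. x) r n)" for n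
  have "sat (e0(0 := u, 1 := v)) (rename_fm \<pi> p) \<longleftrightarrow> v = g u" for u v
  proof -
    have "e0(0 := u, 1 := v) \<circ> \<pi> = mix ((\<lambda>_. x)(0 := v, 1 := u)) r"
      by (auto simp: fun_eq_iff e0_def \<pi>_def mix_def elim!: evenE)
    then show ?thesis using p[of "(\<lambda>_. x)(0 := v, 1 := u)"] sat_rename_fm[OF i] by simp
  qed
  then have "\<exists>z. elts z = {v. \<exists>u\<in>elts x. v = g u}"
    using replacement[of x e0 "rename_fm \<pi> p"] by simp
  moreover have "{v. \<exists>u\<in>elts x. v = g u} = g ` S" unfolding x by auto
  ultimately show ?thesis unfolding small_def by simp
qed

lemma small_UN:
  assumes "small S" "definable_term (\<lambda>e. g (e 0))" shows "small (\<Union>s\<in>S. elts (g s))"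
proof -
  obtain x where x: "g ` S = elts x" using small_image[OF assms] by (rule smallE)
  obtain U where "elts U = (\<Union>y\<in>elts x. elts y)" using union[of x] unfolding is_union_def by blast
  also have "\<dots> = (\<Union>s\<in>S. elts (g s))" using x[symmetric] by auto
  finally show ?thesis unfolding small_def by blast
qed

lemma small_Union: "small S \<Longrightarrow> small (\<Union>s\<in>S. elts s)"
  by (rule small_UN[where g="\<lambda>s. s", OF _ term_var])

lemma small_pair [simp]: "small {a, b}"
  using pairing unfolding small_def by blast

lemma small_Un: assumes "small S" "small T" shows "small (S \<union> T)"
proof -
  obtain x y where "S = elts x" "T = elts y" using assms unfolding small_def by blast
  then show ?thesis using small_Union[OF small_pair[of x y]] by simp
qed

lemma small_empty [simp]: "small {}"
  by (rule small_subset[OF small_pair]) (simp_all add: definable_const)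

lemma small_insert [simp]: assumes "small S" shows "small (insert a S)"
  using small_Un[OF small_pair[of a a] assms] by simp

lemma small_finite: "finite S \<Longrightarrow> small S"
  by (induction S rule: finite_induct) auto

lemma small_Pow: assumes "small S" shows "small {z. elts z \<subseteq> S}"
proof -
  obtain x where x: "S = elts x" using assms(1) by (rule smallE)
  then show ?thesis using power_set[of x] unfolding small_def by simp
qed

lemma small_sep: "definable (\<lambda>e. P (e 0)) \<Longrightarrow> small {u. u \<in> elts x \<and> P u}"
  by (rule small_subset[OF small_elts[of x]]) (auto intro!: definable_intros)

lemma elts_sep: "definable (\<lambda>e. P (e 0)) \<Longrightarrow> elts (the_elt_of {u. u \<in> elts x \<and> P u}) = {u. u \<in> elts x \<and> P u}"
  by (simp add: elts_the_elt_of small_sep)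

section \<open>Pairs and projections as definable terms\<close>

definition upair :: "'a \<Rightarrow> 'a \<Rightarrow> 'a" where
  "upair a b = the_elt_of {u. u = a \<or> u = b}"

definition kpair :: "'a \<Rightarrow> 'a \<Rightarrow> 'a" where
  "kpair a b = upair (upair a a) (upair a b)"

text \<open>Specified through its elements instead of a description operator, so that
  \<open>term_the_elt_of\<close> yields definability at once; on anything that is not a pair the
  value is the empty set.\<close>

definition fstp :: "'a \<Rightarrow> 'a" where
  "fstp p = the_elt_of {u. \<exists>a b. p = kpair a b \<and> u \<in> elts a}"

definition sndp :: "'a \<Rightarrow> 'a" where
  "sndp p = the_elt_of {u. \<exists>a b. p = kpair a b \<and> u \<in> elts b}"

definition adjoin :: "'a \<Rightarrow> 'a \<Rightarrow> 'a" where
  "adjoin a x = the_elt_of {u. u = a \<or> u \<in> elts x}"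

lemma elts_upair [simp]: "elts (upair a b) = {a, b}"
  unfolding upair_def by (subst elts_the_elt_of) (auto simp: insert_def[symmetric] Collect_disj_eq)

lemma upair_eq: "elts z = {a, b} \<longleftrightarrow> z = upair a b"
  by (metis elts_upair elts_inject)

lemma is_pair_iff: "is_pair a b p \<longleftrightarrow> p = kpair a b"
proof -
  have "elts s = {a} \<longleftrightarrow> s = upair a a" for s using upair_eq[of s a a] by simp
  then show ?thesis unfolding is_pair_def kpair_def by (auto simp: upair_eq)
qed

lemma kpair_inject [simp]: "kpair a b = kpair c d \<longleftrightarrow> a = c \<and> b = d"
proof
  assume "kpair a b = kpair c d"
  then have "{upair a a, upair a b} = {upair c c, upair c d}"
    unfolding kpair_def by (metis elts_upair)
  then show "a = c \<and> b = d" by (auto simp: doubleton_eq_iff elts_inject[symmetric] simp del: elts_inject)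
qed simp

lemma fstp_kpair [simp]: "fstp (kpair a b) = a" and sndp_kpair [simp]: "sndp (kpair a b) = b"
  unfolding fstp_def sndp_def by auto

lemma elts_adjoin [simp]: "elts (adjoin a x) = insert a (elts x)"
  unfolding adjoin_def by (subst elts_the_elt_of) (auto simp: insert_def[symmetric] Collect_disj_eq)

lemma term_upair [definable_intros]: "definable_term t \<Longrightarrow> definable_term s \<Longrightarrow> definable_term (\<lambda>e. upair (t e) (s e))"
  by (rule term_lift2) (unfold upair_def, intro definable_intros)

lemma term_kpair [definable_intros]: "definable_term t \<Longrightarrow> definable_term s \<Longrightarrow> definable_term (\<lambda>e. kpair (t e) (s e))"
  unfolding kpair_def by (intro definable_intros)

lemma term_fstp [definable_intros]: "definable_term t \<Longrightarrow> definable_term (\<lambda>e. fstp (t e))"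
  by (rule term_lift1) (unfold fstp_def, intro definable_intros)

lemma term_sndp [definable_intros]: "definable_term t \<Longrightarrow> definable_term (\<lambda>e. sndp (t e))"
  by (rule term_lift1) (unfold sndp_def, intro definable_intros)

lemma term_adjoin [definable_intros]: "definable_term t \<Longrightarrow> definable_term s \<Longrightarrow> definable_term (\<lambda>e. adjoin (t e) (s e))"
  by (rule term_lift2) (unfold adjoin_def, intro definable_intros)

lemma not_mem_self: "x \<notin> elts x"
proof
  assume "x \<in> elts x"
  then show False using foundation[of "upair x x"] by auto
qed

lemma maps_to_iff: "maps_to f a b \<longleftrightarrow> kpair a b \<in> elts f"
  unfolding maps_to_def is_pair_iff by simp

lemma definable_maps_to [definable_intros]: "definable_term t \<Longrightarrow> definable_term s \<Longrightarrow> definable_term u \<Longrightarrow> definable (\<lambda>e. maps_to (t e) (s e) (u e))"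
  unfolding maps_to_iff by (intro definable_intros)

section \<open>Natural numbers and bijections of the model\<close>

lemma is_inductive_iff:
  "is_inductive w \<longleftrightarrow> the_elt_of {} \<in> elts w \<and> (\<forall>x\<in>elts w. adjoin x x \<in> elts w)"
proof -
  have "elts z = {} \<longleftrightarrow> z = the_elt_of {}" for z
    by (metis the_elt_of_elts elts_the_elt_of small_empty)
  moreover have "is_succ x s \<longleftrightarrow> s = adjoin x x" for x s
    unfolding is_succ_def by (metis elts_adjoin elts_inject)
  ultimately show ?thesis unfolding is_inductive_def by simp
qed

lemma elts_the_elt_of_empty [simp]: "elts (the_elt_of {}) = {}"
  by (simp add: elts_the_elt_of)

lemma definable_is_nat [definable_intros]: "definable_term t \<Longrightarrow> definable (\<lambda>e. is_nat (t e))"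
  by (rule definable_lift1) (unfold is_nat_def is_inductive_iff, intro definable_intros)

lemma is_nat_0 [simp]: "is_nat (the_elt_of {})"
  unfolding is_nat_def is_inductive_iff by blast

lemma is_nat_succ: "is_nat n \<Longrightarrow> is_nat (adjoin n n)"
  unfolding is_nat_def is_inductive_iff by blast

text \<open>The subset of an inductive set carved out by \<open>Q\<close> must be a set of the
  model, hence the definability premise. In return the induction also reaches nonstandard
  \<open>m\<close>.\<close>

lemma nat_induct_model [consumes 1, case_names definable zero succ]:
  assumes "is_nat m" "definable (\<lambda>e. Q (e 0))" "Q (the_elt_of {})" "\<And>n. is_nat n \<Longrightarrow> Q n \<Longrightarrow> Q (adjoin n n)"
  shows "Q m"
proof -
  obtain w where w: "is_inductive w" using infinity by blast
  define v where "v = the_elt_of {n. n \<in> elts w \<and> is_nat n \<and> Q n}"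
  have v: "elts v = {n. n \<in> elts w \<and> is_nat n \<and> Q n}"
    unfolding v_def by (rule elts_sep) (intro definable_intros assms)
  have "is_inductive v"
    using w assms(3,4) is_nat_succ unfolding is_inductive_iff v by auto
  then have "m \<in> elts v" using assms(1) unfolding is_nat_def by blast
  then show ?thesis by (simp add: v)
qed

lemma is_bijectionD:
  assumes "is_bijection f x y"
  shows "kpair a b \<in> elts f \<Longrightarrow> a \<in> elts x \<and> b \<in> elts y"
    and "kpair a b \<in> elts f \<Longrightarrow> kpair a b' \<in> elts f \<Longrightarrow> b = b'"
    and "kpair a b \<in> elts f \<Longrightarrow> kpair a' b \<in> elts f \<Longrightarrow> a = a'"
    and "a \<in> elts x \<Longrightarrow> \<exists>b. kpair a b \<in> elts f"
    and "b \<in> elts y \<Longrightarrow> \<exists>a. kpair a b \<in> elts f"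
    and "p \<in> elts f \<Longrightarrow> \<exists>a b. p = kpair a b"
proof -
  note f = assms[unfolded is_bijection_def is_function_def maps_to_iff is_pair_iff]
  show 1: "a \<in> elts x \<and> b \<in> elts y" if "kpair a b \<in> elts f" for a b
    using f that by fastforce
  show "b = b'" if "kpair a b \<in> elts f" "kpair a b' \<in> elts f"
    using f that 1 by blast
  show "a = a'" if "kpair a b \<in> elts f" "kpair a' b \<in> elts f"
    using f that 1 by blast
  show "a \<in> elts x \<Longrightarrow> \<exists>b. kpair a b \<in> elts f" "b \<in> elts y \<Longrightarrow> \<exists>a. kpair a b \<in> elts f"
    "p \<in> elts f \<Longrightarrow> \<exists>a b. p = kpair a b" using f by blast+
qed

lemma is_bijectionI:
  assumes "\<And>p. p \<in> elts f \<Longrightarrow> \<exists>a\<in>elts x. \<exists>b\<in>elts y. p = kpair a b"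
    and "\<And>a. a \<in> elts x \<Longrightarrow> \<exists>!b. kpair a b \<in> elts f"
    and "\<And>b. b \<in> elts y \<Longrightarrow> \<exists>!a. kpair a b \<in> elts f"
  shows "is_bijection f x y"
  using assms unfolding is_bijection_def is_function_def maps_to_iff is_pair_iff by blast

lemma equinumerous_empty: "equinumerous x (the_elt_of {}) \<longleftrightarrow> elts x = {}"
proof
  assume "elts x = {}"
  then have "is_bijection (the_elt_of {}) x (the_elt_of {})"
    unfolding is_bijection_def is_function_def maps_to_iff by simp
  then show "equinumerous x (the_elt_of {})" unfolding equinumerous_def by blast
next
  assume "equinumerous x (the_elt_of {})"
  then obtain f where f: "is_bijection f x (the_elt_of {})" unfolding equinumerous_def by blast
  show "elts x = {}" using is_bijectionD(1,4)[OF f] by fastforce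
qed

text \<open>The successor \<open>adjoin m m\<close> has \<open>m\<close> as its only new element,
  since foundation keeps \<open>m\<close> out of itself; the new point is matched with it.\<close>

lemma equinumerous_insert:
  assumes "equinumerous x m" "a \<notin> elts x"
  shows "equinumerous (adjoin a x) (adjoin m m)"
proof -
  obtain f where f: "is_bijection f x m" using assms unfolding equinumerous_def by blast
  note d = is_bijectionD[OF f]
  have m: "m \<notin> elts m" by (rule not_mem_self)
  have "is_bijection (adjoin (kpair a m) f) (adjoin a x) (adjoin m m)"
  proof (rule is_bijectionI)
    fix p assume "p \<in> elts (adjoin (kpair a m) f)"
    then show "\<exists>a'\<in>elts (adjoin a x). \<exists>b\<in>elts (adjoin m m). p = kpair a' b"
      using d(1,6) by fastforce
  next
    fix c assume "c \<in> elts (adjoin a x)"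
    then show "\<exists>!b. kpair c b \<in> elts (adjoin (kpair a m) f)"
      using assms(2) d(1,2,4) by (simp, metis)
  next
    fix c assume "c \<in> elts (adjoin m m)"
    then show "\<exists>!b. kpair b c \<in> elts (adjoin (kpair a m) f)"
      using m d(1,3,5) by (simp, metis)
  qed
  then show ?thesis unfolding equinumerous_def by blast
qed

lemma equinumerous_succE:
  assumes "equinumerous x (adjoin m m)"
  obtains a x' where "a \<notin> elts x'" "x = adjoin a x'" "equinumerous x' m"
proof -
  obtain f where f: "is_bijection f x (adjoin m m)" using assms unfolding equinumerous_def by blast
  note d = is_bijectionD[OF f]
  have m: "m \<notin> elts m" by (rule not_mem_self)
  obtain a where a: "kpair a m \<in> elts f" using d(5)[of m] by auto
  define x' where "x' = the_elt_of {u. u \<in> elts x \<and> u \<noteq> a}"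
  have x': "elts x' = {u. u \<in> elts x \<and> u \<noteq> a}"
    unfolding x'_def by (rule elts_sep) (intro definable_intros)
  define f' where "f' = the_elt_of {u. u \<in> elts f \<and> u \<noteq> kpair a m}"
  have f': "elts f' = {u. u \<in> elts f \<and> u \<noteq> kpair a m}"
    unfolding f'_def by (rule elts_sep) (intro definable_intros)
  have "is_bijection f' x' m"
  proof (rule is_bijectionI)
    fix p assume "p \<in> elts f'"
    then obtain c b where p: "p = kpair c b" "kpair c b \<in> elts f" "kpair c b \<noteq> kpair a m"
      using f' d(6)[of p] by auto
    then have "c \<noteq> a" "b \<noteq> m" using a d(2,3) by (metis)+
    then show "\<exists>a\<in>elts x'. \<exists>b\<in>elts m. p = kpair a b"
      using p d(1)[OF p(2)] x' by auto
  next
    fix c assume "c \<in> elts x'"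
    then have "c \<in> elts x" "c \<noteq> a" by (auto simp: x')
    then show "\<exists>!b. kpair c b \<in> elts f'" unfolding f' using d(2,4) by (simp, metis)
  next
    fix c assume "c \<in> elts m"
    then have "c \<in> elts (adjoin m m)" "c \<noteq> m" using m by auto
    then show "\<exists>!b. kpair b c \<in> elts f'" unfolding f' using d(3,5) by (simp, metis)
  qed
  moreover have "x = adjoin a x'"
    using d(1)[OF a] x' by (intro extensionality) auto
  ultimately show thesis using that[of a x'] x' unfolding equinumerous_def by blast
qed


lemma definable_ex1 [definable_intros]:
  assumes "definable (\<lambda>e. P (\<lambda>n. e (Suc n)) (e 0))" shows "definable (\<lambda>e. \<exists>!a. P e a)"
proof -
  have P': "definable (\<lambda>e. P (\<lambda>n. e (Suc (Suc n))) (e 0))"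
    using definable_reindex[OF _ assms, of "\<lambda>n. case n of 0 \<Rightarrow> 0 | Suc m \<Rightarrow> Suc (Suc m)"]
    by (simp add: inj_def split: nat.splits)
  show ?thesis unfolding Ex1_def by (intro definable_intros assms P')
qed

lemma definable_app1: assumes "definable (\<lambda>e. P (e 0))" "definable_term t" shows "definable (\<lambda>e. P (t e))"
  by (rule definable_subst[where P="\<lambda>e a. P a", OF assms])

lemma definable_app2:
  assumes R: "definable (\<lambda>e. R (e 0) (e 1))" and "definable_term t" "definable_term s" shows "definable (\<lambda>e. R (t e) (s e))"
proof -
  have "definable (\<lambda>e. R (e 1) (e 0))"
    using definable_reindex[OF _ R, of "\<lambda>n. if n = 0 then 1 else if n = 1 then 0 else n"]
    by (simp add: inj_def)
  then have "definable (\<lambda>e. \<exists>a b. (a = t e \<and> b = s e) \<and> R a b)"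
    by (intro definable_intros term_shift assms(2,3)) simp
  then show ?thesis by simp
qed

definition definable_fun :: "('a \<Rightarrow> 'a) \<Rightarrow> bool" where
  "definable_fun g \<longleftrightarrow> definable_term (\<lambda>e. g (e 0))"

lemma term_app1: assumes "definable_fun g" "definable_term t" shows "definable_term (\<lambda>e. g (t e))"
proof -
  have "definable (\<lambda>e. e 0 = g (e 1))" using assms(1) unfolding definable_fun_def definable_term_def by simp
  from definable_app2[of "\<lambda>x y. x = g y", OF this term_var term_shift[OF assms(2)]]
  show ?thesis unfolding definable_term_def .
qed

lemma definable_funI: "definable_term (\<lambda>e. g (e 0)) \<Longrightarrow> definable_fun g"
  unfolding definable_fun_def .

lemma definable_elts_eq [definable_intros]:
  assumes "definable_term t" "definable (\<lambda>e. e 0 \<in> S (\<lambda>n. e (Suc n)))" shows "definable (\<lambda>e. elts (t e) = S e)"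
  unfolding set_eq_iff by (intro definable_intros definable_iff term_shift assms)

lemma definable_in_Collect [definable_intros]: "definable (\<lambda>e. P e (t e)) \<Longrightarrow> definable (\<lambda>e. t e \<in> {u. P e u})"
  by simp

lemma definable_in_Un [definable_intros]:
  "definable (\<lambda>e. t e \<in> A e) \<Longrightarrow> definable (\<lambda>e. t e \<in> B e) \<Longrightarrow> definable (\<lambda>e. t e \<in> A e \<union> B e)"
  unfolding Un_iff by (rule definable_disj)

lemma definable_in_insert [definable_intros]:
  "definable_term t \<Longrightarrow> definable_term s \<Longrightarrow> definable (\<lambda>e. t e \<in> A e) \<Longrightarrow> definable (\<lambda>e. t e \<in> insert (s e) (A e))"
  unfolding insert_iff by (intro definable_intros)

lemma definable_in_image [definable_intros]:
  "definable (\<lambda>e. \<exists>x\<in>elts (s e). t e = G e x) \<Longrightarrow> definable (\<lambda>e. t e \<in> G e ` elts (s e))"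
  unfolding image_iff .

lemma definable_in_UN [definable_intros]:
  "definable (\<lambda>e. \<exists>x\<in>elts (s e). t e \<in> G e x) \<Longrightarrow> definable (\<lambda>e. t e \<in> (\<Union>x\<in>elts (s e). G e x))"
  by simp

section \<open>Finiteness in the sense of the model\<close>

lemma definable_equinumerous [definable_intros]:
  "definable_term t \<Longrightarrow> definable_term s \<Longrightarrow> definable (\<lambda>e. equinumerous (t e) (s e))"
  by (rule definable_lift2)
     (unfold equinumerous_def is_bijection_def is_function_def is_pair_iff, intro definable_intros)

lemma definable_is_finite [definable_intros]: "definable_term t \<Longrightarrow> definable (\<lambda>e. is_finite (t e))"
  by (rule definable_lift1) (unfold is_finite_def, intro definable_intros)

lemma is_finite_induct [consumes 1, case_names definable empty adjoin]:
  assumes "is_finite x" "definable (\<lambda>e. Q (e 0))" "Q (the_elt_of {})"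
    and "\<And>a x. is_finite x \<Longrightarrow> a \<notin> elts x \<Longrightarrow> Q x \<Longrightarrow> Q (adjoin a x)"
  shows "Q x"
proof -
  have "\<forall>x. equinumerous x m \<longrightarrow> Q x" if "is_nat m" for m
    using that
  proof (induction m rule: nat_induct_model)
    case definable
    show ?case by (intro definable_intros definable_app1[OF assms(2)])
  next
    case zero
    have "x = the_elt_of {}" if "equinumerous x (the_elt_of {})" for x
      using that by (intro extensionality) (simp add: equinumerous_empty)
    then show ?case using assms(3) by blast
  next
    case (succ n)
    show ?case
    proof (intro allI impI)
      fix x assume "equinumerous x (adjoin n n)"
      then obtain a x' where x: "a \<notin> elts x'" "x = adjoin a x'" "equinumerous x' n"
        by (rule equinumerous_succE)
      moreover have "is_finite x'" using x(3) succ(1) unfolding is_finite_def by blast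
      ultimately show "Q x" using assms(4) succ(2) by blast
    qed
  qed
  then show ?thesis using assms(1) unfolding is_finite_def by blast
qed

text \<open>Lifts finiteness in the model to HOL sets. It is weaker than \<open>finite\<close>: with
  nonstandard natural numbers an internally finite set can be infinite in HOL.\<close>

definition internally_finite :: "'a set \<Rightarrow> bool" where
  "internally_finite S \<longleftrightarrow> (\<exists>z. elts z = S \<and> is_finite z)"

lemma internally_finite_elts [simp]: "internally_finite (elts x) \<longleftrightarrow> is_finite x"
  unfolding internally_finite_def by auto

lemma internally_finite_small: "internally_finite S \<Longrightarrow> small S"
  unfolding internally_finite_def small_def by blast

lemma definable_ifin [definable_intros]:
  assumes "definable (\<lambda>e. e 0 \<in> S (\<lambda>n. e (Suc n)))" shows "definable (\<lambda>e. internally_finite (S e))"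
proof -
  have "definable (\<lambda>e. e 0 \<in> S (\<lambda>n. e (Suc (Suc n))))"
    using definable_reindex[OF _ assms, of "\<lambda>n. case n of 0 \<Rightarrow> 0 | Suc m \<Rightarrow> Suc (Suc m)"]
    by (simp add: inj_def split: nat.splits)
  then show ?thesis unfolding internally_finite_def by (intro definable_intros)
qed

lemma internally_finite_empty [simp]: "internally_finite {}"
proof -
  have "is_finite (the_elt_of {})"
    unfolding is_finite_def by (intro exI[of _ "the_elt_of {}"]) (simp add: equinumerous_empty)
  then show ?thesis unfolding internally_finite_def by (intro exI[of _ "the_elt_of {}"]) simp
qed

lemma internally_finite_insert [simp]: assumes "internally_finite S" shows "internally_finite (insert a S)"
proof (cases "a \<in> S")
  case True
  then show ?thesis using assms by (simp add: insert_absorb)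
next
  case False
  obtain z m where z: "elts z = S" "is_nat m" "equinumerous z m"
    using assms unfolding internally_finite_def is_finite_def by blast
  then have "is_finite (adjoin a z)"
    unfolding is_finite_def using equinumerous_insert[of z m a] is_nat_succ False by blast
  then show ?thesis unfolding internally_finite_def using z(1) by (intro exI[of _ "adjoin a z"]) simp
qed

lemma internally_finite_induct [consumes 1, case_names definable empty insert]:
  assumes "internally_finite S" "definable (\<lambda>e. P (elts (e 0)))" "P {}"
    and "\<And>a S. internally_finite S \<Longrightarrow> a \<notin> S \<Longrightarrow> P S \<Longrightarrow> P (insert a S)"
  shows "P S"
proof -
  obtain x where x: "elts x = S" "is_finite x" using assms(1) unfolding internally_finite_def by blast
  have "P (elts x)"
    by (rule is_finite_induct[OF x(2), of "\<lambda>x. P (elts x)"]) (use assms(2-4) in \<open>auto\<close>)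
  then show ?thesis using x by simp
qed

lemma internally_finite_finite: "finite S \<Longrightarrow> internally_finite S"
  by (induction S rule: finite_induct) auto

text \<open>A HOL subset of an internally finite set need not be an element of the model, for
  instance the standard part of a nonstandard number; \<open>small T\<close> rules this out.\<close>

lemma internally_finite_subset: assumes "internally_finite S" "T \<subseteq> S" "small T" shows "internally_finite T"
proof -
  have "\<forall>z. elts z \<subseteq> S \<longrightarrow> is_finite z" using assms(1)
  proof (induction S rule: internally_finite_induct)
    case definable
    show ?case by (intro definable_intros)
  next
    case empty
    then show ?case using internally_finite_empty internally_finite_elts by (metis subset_empty)
  next
    case (insert a S)
    show ?case
    proof (intro allI impI)
      fix z assume z: "elts z \<subseteq> insert a S"
      define z' where "z' = the_elt_of {u. u \<in> elts z \<and> u \<noteq> a}"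
      have z': "elts z' = {u. u \<in> elts z \<and> u \<noteq> a}"
        unfolding z'_def by (rule elts_sep) (intro definable_intros)
      then have "elts z' \<subseteq> S" using z by auto
      then have f: "is_finite z'" using insert(3) by blast
      then have "is_finite (adjoin a z')" using internally_finite_insert[of "elts z'" a] internally_finite_elts[of "adjoin a z'"] by simp
      moreover have "z = z' \<or> z = adjoin a z'"
        unfolding elts_inject[symmetric] elts_adjoin using z' by auto
      ultimately show "is_finite z" using f by auto
    qed
  qed
  moreover obtain z where "T = elts z" using assms(3) by (rule smallE)
  ultimately show ?thesis using assms(2) by auto
qed

lemma internally_finite_Un: assumes "internally_finite S" "internally_finite T" shows "internally_finite (S \<union> T)"
proof -
  obtain t where t: "T = elts t" using internally_finite_small[OF assms(2)] by (rule smallE)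
  show ?thesis unfolding t using assms(1)
  proof (induction S rule: internally_finite_induct)
    case definable
    show ?case by (intro definable_intros)
  qed (use assms t in auto)
qed

lemma internally_finite_image: assumes "internally_finite S" "definable_fun g" shows "internally_finite (g ` S)"
  using assms(1)
proof (induction S rule: internally_finite_induct)
  case definable
  show ?case by (intro definable_intros term_app1[OF assms(2)])
qed auto

lemma internally_finite_UN:
  assumes "internally_finite S" "\<And>s. s \<in> S \<Longrightarrow> internally_finite (elts (g s))" "definable_fun g"
  shows "internally_finite (\<Union>s\<in>S. elts (g s))"
proof -
  have "(\<forall>s\<in>S. internally_finite (elts (g s))) \<longrightarrow> internally_finite (\<Union>s\<in>S. elts (g s))" using assms(1)
  proof (induction S rule: internally_finite_induct)
    case definable
    show ?case by (intro definable_intros term_app1[OF assms(3)])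
  qed (auto intro: internally_finite_Un)
  then show ?thesis using assms(2) by blast
qed

lemma definable_fun_ident: "definable_fun (\<lambda>s. s)"
  by (intro definable_funI definable_intros)

lemma internally_finite_Union: "internally_finite S \<Longrightarrow> (\<And>s. s \<in> S \<Longrightarrow> internally_finite (elts s)) \<Longrightarrow> internally_finite (\<Union>s\<in>S. elts s)"
  by (rule internally_finite_UN[where g="\<lambda>s. s", OF _ _ definable_fun_ident])

lemma internally_finite_Pow: assumes "internally_finite S" shows "internally_finite {z. elts z \<subseteq> S}"
  using assms
proof (induction S rule: internally_finite_induct)
  case definable
  show ?case by (intro definable_intros)
next
  case empty
  have "{z. elts z \<subseteq> {}} = {the_elt_of {}}" by (auto simp flip: elts_inject)
  then show ?case by simp
next
  case (insert a S)
  have "{z. elts z \<subseteq> insert a S} = {z. elts z \<subseteq> S} \<union> adjoin a ` {z. elts z \<subseteq> S}"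
  proof (intro equalityI subsetI)
    fix z assume "z \<in> {z. elts z \<subseteq> insert a S}"
    then have z: "elts z \<subseteq> insert a S" by simp
    define z' where "z' = the_elt_of {u. u \<in> elts z \<and> u \<noteq> a}"
    have z': "elts z' = {u. u \<in> elts z \<and> u \<noteq> a}"
      unfolding z'_def by (rule elts_sep) (intro definable_intros)
    then have "elts z' \<subseteq> S" using z by auto
    moreover have "z = z' \<or> z = adjoin a z'"
      unfolding elts_inject[symmetric] elts_adjoin using z' by auto
    ultimately show "z \<in> {z. elts z \<subseteq> S} \<union> adjoin a ` {z. elts z \<subseteq> S}" by auto
  qed auto
  moreover have "internally_finite (adjoin a ` {z. elts z \<subseteq> S})"
    by (rule internally_finite_image[OF insert(3)]) (intro definable_funI definable_intros)
  ultimately show ?case using internally_finite_Un[OF insert(3)] by simp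
qed

lemma internally_finite_minimal:
  assumes "internally_finite S" "S \<noteq> {}" shows "\<exists>d\<in>S. \<forall>d'\<in>S. \<not> elts d' \<subset> elts d"
proof -
  have "S \<noteq> {} \<longrightarrow> (\<exists>d\<in>S. \<forall>d'\<in>S. \<not> elts d' \<subset> elts d)" using assms(1)
  proof (induction S rule: internally_finite_induct)
    case definable
    have *: "elts x \<noteq> {} \<longleftrightarrow> (\<exists>u. u \<in> elts x)" for x by auto
    show ?case unfolding psubset_eq * by (intro definable_intros)
  next
    case empty
    then show ?case by simp
  next
    case (insert a S)
    show ?case
    proof (cases "S = {}")
      case False
      then obtain d where "d \<in> S" "\<forall>d'\<in>S. \<not> elts d' \<subset> elts d" using insert by blast
      then show ?thesis by (cases "elts a \<subset> elts d") (metis insert_iff less_irrefl psubset_trans)+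
    qed auto
  qed
  then show ?thesis using assms(2) by simp
qed

section \<open>Standard numerals and cardinalities\<close>

lemma ex_numeral: "\<exists>s. is_numeral k s"
proof (induction k)
  case 0
  then show ?case using elts_the_elt_of_empty by (auto simp del: elts_the_elt_of_empty)
next
  case (Suc k)
  then show ?case unfolding is_numeral.simps is_succ_def by (metis elts_adjoin)
qed

lemma is_numeral_0_iff: "is_numeral 0 s \<longleftrightarrow> s = the_elt_of {}"
  by (simp flip: elts_inject)

lemma is_numeral_Suc_iff: "is_numeral (Suc k) s \<longleftrightarrow> (\<exists>n. is_numeral k n \<and> s = adjoin n n)"
  unfolding is_numeral.simps is_succ_def by (metis elts_adjoin elts_inject)

lemma is_numeral_card: "is_numeral k s \<Longrightarrow> is_nat s \<and> finite (elts s) \<and> card (elts s) = k"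
proof (induction k arbitrary: s)
  case 0
  then show ?case using is_numeral_0_iff[of s] by (simp del: is_numeral.simps)
next
  case (Suc k)
  then obtain n where n: "is_numeral k n" "s = adjoin n n" unfolding is_numeral_Suc_iff by blast
  then show ?case using Suc.IH[of n] is_nat_succ not_mem_self[of n] by auto
qed

text \<open>For a standard number the cardinality of the model agrees with that of HOL. This lets
  the combinatorics of classes with at most six elements be carried out in HOL.\<close>

lemma equinumerous_numeral:
  "is_numeral k s \<Longrightarrow> equinumerous z s \<longleftrightarrow> finite (elts z) \<and> card (elts z) = k"
proof (induction k arbitrary: s z)
  case 0
  then show ?case using is_numeral_0_iff[of s] by (auto simp: equinumerous_empty simp del: is_numeral.simps)
next
  case (Suc k)
  then obtain n where n: "is_numeral k n" "s = adjoin n n" unfolding is_numeral_Suc_iff by blast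
  show ?case
  proof
    assume "equinumerous z s"
    then obtain a x' where "a \<notin> elts x'" "z = adjoin a x'" "equinumerous x' n"
      unfolding n(2) by (rule equinumerous_succE)
    then show "finite (elts z) \<and> card (elts z) = Suc k" using Suc.IH[OF n(1), of x'] by simp
  next
    assume z: "finite (elts z) \<and> card (elts z) = Suc k"
    then obtain a T where T: "elts z = insert a T" "a \<notin> T" "card T = k" "finite T"
      by (metis card_Suc_eq finite_insert)
    obtain x' where x': "T = elts x'" using small_finite[OF T(4)] by (rule smallE)
    have "z = adjoin a x'" using T x' by (simp flip: elts_inject)
    then show "equinumerous z s"
      unfolding n(2) using T x' equinumerous_insert Suc.IH[OF n(1), of x'] by simp
  qed
qed

definition has_card :: "'a set \<Rightarrow> nat \<Rightarrow> bool" where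
  "has_card S k \<longleftrightarrow> finite S \<and> card S = k"

lemma definable_has_card [definable_intros]: "definable_term t \<Longrightarrow> definable (\<lambda>e. has_card (elts (t e)) k)"
proof -
  assume t: "definable_term t"
  obtain s where s: "is_numeral k s" using ex_numeral by blast
  show ?thesis unfolding has_card_def equinumerous_numeral[OF s, symmetric]
    by (intro definable_intros t)
qed

text \<open>The implication makes every HOL-infinite set large; \<open>card\<close> alone would give
  0 for an internally finite set of nonstandard size.\<close>

definition exceeds :: "nat \<Rightarrow> 'a set \<Rightarrow> bool" where
  "exceeds k S \<longleftrightarrow> (finite S \<longrightarrow> k < card S)"

lemma exceeds_iff: "exceeds k S \<longleftrightarrow> (\<forall>j\<in>{..k}. \<not> has_card S j)"
  unfolding exceeds_def has_card_def by (auto simp: not_less)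

lemma definable_exceeds [definable_intros]: "definable_term t \<Longrightarrow> definable (\<lambda>e. exceeds k (elts (t e)))"
  unfolding exceeds_iff by (intro definable_ball_finite definable_intros) auto

lemma nat_subset: assumes "is_nat m" "n \<in> elts m" shows "elts n \<subseteq> elts m"
proof -
  have "\<forall>n\<in>elts m. elts n \<subseteq> elts m" using assms(1)
  proof (induction m rule: nat_induct_model)
    case definable
    show ?case by (intro definable_intros)
  qed auto
  then show ?thesis using assms by blast
qed

lemma is_numeral_unique: "is_numeral k s \<Longrightarrow> is_numeral k s' \<Longrightarrow> s = s'"
proof (induction k arbitrary: s s')
  case 0
  then show ?case using is_numeral_0_iff by metis
next
  case (Suc k)
  then show ?case unfolding is_numeral_Suc_iff by metis
qed

lemma definable_is_numeral [definable_intros]: assumes "definable_term t" shows "definable (\<lambda>e. is_numeral k (t e))"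
proof -
  obtain s where "is_numeral k s" using ex_numeral by blast
  then have "is_numeral k = (\<lambda>x. x = s)" using is_numeral_unique by blast
  then show ?thesis by (simp add: definable_intros assms)
qed

text \<open>The second alternative is a disjunction over finitely many HOL numbers, hence definable,
  so the induction of the model applies. In the successor step a numeral j < \<open>k\<close> passes
  to j+1.\<close>

lemma nat_gt_numeral:
  assumes "is_nat m" "is_numeral k s" shows "s \<in> elts m \<or> (\<exists>j\<in>{..k}. is_numeral j m)"
  using assms(1)
proof (induction m rule: nat_induct_model)
  case definable
  show ?case by (intro definable_intros definable_bex_finite) auto
next
  case zero
  then show ?case using is_numeral_0_iff by blast
next
  case (succ n)
  show ?case
  proof (cases "s \<in> elts n \<or> s = n")
    case False
    then obtain j where j: "j \<le> k" "is_numeral j n" using succ(2) by auto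
    then have "j \<noteq> k" using is_numeral_unique[OF assms(2), of n] False by auto
    then have "Suc j \<le> k" using j by simp
    moreover have "is_numeral (Suc j) (adjoin n n)" using j(2) unfolding is_numeral_Suc_iff by blast
    ultimately show ?thesis by blast
  qed auto
qed

lemma equinumerous_bij_betw: assumes "equinumerous x y" shows "\<exists>h. bij_betw h (elts x) (elts y)"
proof -
  obtain f where f: "is_bijection f x y" using assms unfolding equinumerous_def by blast
  note d = is_bijectionD[OF f]
  define h where "h a = (SOME b. kpair a b \<in> elts f)" for a
  have h: "kpair a (h a) \<in> elts f" if "a \<in> elts x" for a
    unfolding h_def by (rule someI_ex) (rule d(4)[OF that])
  have "bij_betw h (elts x) (elts y)"
    by (rule bij_betwI') (use h d in \<open>metis\<close>)+
  then show ?thesis by blast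
qed

lemma finite_card_gt_iff:
  assumes s: "is_numeral k s" shows "finite_card_gt s x \<longleftrightarrow> is_finite x \<and> exceeds k (elts x)"
proof
  assume "finite_card_gt s x"
  then obtain m where m: "is_nat m" "s \<in> elts m" "equinumerous x m"
    unfolding finite_card_gt_def by blast
  obtain h where h: "bij_betw h (elts x) (elts m)" using equinumerous_bij_betw[OF m(3)] by blast
  \<comment> \<open>Since \<open>m\<close> is transitive, it contains \<open>s\<close> together with
    all elements of \<open>s\<close>, and these are k+1 objects.\<close>
  have sub: "elts (adjoin s s) \<subseteq> elts m" using nat_subset[OF m(1,2)] m(2) by simp
  have "k < card (elts x)" if "finite (elts x)"
  proof -
    have "finite (elts m)" using h that bij_betw_finite by blast
    then have "card (elts (adjoin s s)) \<le> card (elts m)" using sub by (rule card_mono)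
    then show ?thesis
      using bij_betw_same_card[OF h] is_numeral_card[OF s] not_mem_self[of s] by simp
  qed
  then show "is_finite x \<and> exceeds k (elts x)"
    using m unfolding is_finite_def exceeds_def by blast
next
  assume x: "is_finite x \<and> exceeds k (elts x)"
  then obtain m where m: "is_nat m" "equinumerous x m" unfolding is_finite_def by blast
  have "\<not> is_numeral j m" if "j \<le> k" for j
    using x m(2) equinumerous_numeral[of j m x] that unfolding exceeds_def by auto
  then have "s \<in> elts m" using nat_gt_numeral[OF m(1) s] by auto
  then show "finite_card_gt s x" unfolding finite_card_gt_def using m by blast
qed

section \<open>The two principles expressed by definable class functions\<close>

definition selects :: "nat \<Rightarrow> 'a \<Rightarrow> ('a \<Rightarrow> 'a) \<Rightarrow> bool" where
  "selects k y \<phi> \<longleftrightarrow> definable_fun \<phi> \<and>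
     (\<forall>z. elts z \<subseteq> elts y \<and> is_finite z \<and> exceeds k (elts z) \<longrightarrow>
       elts (\<phi> z) \<subseteq> elts z \<and> has_card (elts (\<phi> z)) k)"

text \<open>A function that is an element of the model becomes a HOL function with a definable
  graph, which can be nested in terms and stays usable on every subset of \<open>y\<close>.\<close>

lemma nRC_fin_selects:
  assumes "is_numeral k s" "nRC_fin s" "\<not> is_finite x"
  shows "\<exists>y \<phi>. elts y \<subseteq> elts x \<and> \<not> is_finite y \<and> selects k y \<phi>"
proof -
  obtain y D C f where y: "elts y \<subseteq> elts x" "\<not> is_finite y"
    and D: "is_subsets_card_gt s y D" and C: "is_subsets_card s y C" and f: "is_function f D C"
    and sub: "\<And>z v. z \<in> elts D \<Longrightarrow> maps_to f z v \<Longrightarrow> elts v \<subseteq> elts z"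
    using assms(2,3) unfolding nRC_fin_def by blast
  \<comment> \<open>Collecting the elements of all values of \<open>f\<close> at \<open>z\<close>
    recovers the unique value without a description operator.\<close>
  define \<phi> where "\<phi> z = the_elt_of {u. \<exists>v. maps_to f z v \<and> u \<in> elts v}" for z
  have "definable_fun \<phi>" unfolding \<phi>_def by (intro definable_funI definable_intros)
  moreover have "elts (\<phi> z) \<subseteq> elts z \<and> has_card (elts (\<phi> z)) k"
    if "elts z \<subseteq> elts y" "is_finite z" "exceeds k (elts z)" for z
  proof -
    have z: "z \<in> elts D"
      using D that unfolding is_subsets_card_gt_def finite_card_gt_iff[OF assms(1)] by simp
    then obtain v where v: "maps_to f z v" "\<And>v'. maps_to f z v' \<Longrightarrow> v' = v"
      using f unfolding is_function_def by blast
    have "{u. \<exists>v. maps_to f z v \<and> u \<in> elts v} = elts v" using v by blast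
    then have \<phi>: "\<phi> z = v" unfolding \<phi>_def by simp
    obtain p where p: "p \<in> elts f" "is_pair z v p" using v(1) unfolding maps_to_def by blast
    then have "v \<in> elts C" using f unfolding is_function_def is_pair_iff by fastforce
    then show ?thesis
      using sub[OF z v(1)] C \<phi> equinumerous_numeral[OF assms(1), of v]
      unfolding is_subsets_card_def has_card_def by auto
  qed
  ultimately show ?thesis using y unfolding selects_def by blast
qed

text \<open>The way back into the model: replacement turns the definable \<open>g\<close> into a set
  of pairs, and power set with separation provides its codomain.\<close>

lemma nC_minus_finI:
  assumes s: "is_numeral k s"
    and main: "\<And>F. \<not> is_finite F \<Longrightarrow> (\<And>A. A \<in> elts F \<Longrightarrow> is_finite A \<and> exceeds k (elts A)) \<Longrightarrow>
      \<exists>B g. elts B \<subseteq> elts F \<and> \<not> is_finite B \<and> definable_fun g \<and>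
        (\<forall>A\<in>elts B. elts (g A) \<subseteq> elts A \<and> has_card (elts (g A)) k)"
  shows "nC_minus_fin s"
  unfolding nC_minus_fin_def
proof (intro allI impI)
  fix F assume "\<not> is_finite F \<and> (\<forall>A\<in>elts F. finite_card_gt s A)"
  then obtain B g where B: "elts B \<subseteq> elts F" "\<not> is_finite B" "definable_fun g"
    and g: "\<And>A. A \<in> elts B \<Longrightarrow> elts (g A) \<subseteq> elts A \<and> has_card (elts (g A)) k"
    using main[of F] unfolding finite_card_gt_iff[OF s] by blast
  obtain U where U: "is_union B U" using union by blast
  obtain P where P: "elts P = {y. elts y \<subseteq> elts U}" using power_set by blast
  define C where "C = the_elt_of {z. z \<in> elts P \<and> equinumerous z s}"
  have C': "elts C = {z. z \<in> elts P \<and> equinumerous z s}"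
    unfolding C_def by (rule elts_sep) (intro definable_intros)
  then have C: "is_subsets_card s U C" using P unfolding is_subsets_card_def by auto
  have "small ((\<lambda>A. kpair A (g A)) ` elts B)"
    by (rule small_image) (intro small_elts definable_intros term_app1[OF B(3)])+
  then obtain f where f: "elts f = (\<lambda>A. kpair A (g A)) ` elts B" by (metis smallE)
  then have m: "maps_to f A v \<longleftrightarrow> A \<in> elts B \<and> v = g A" for A v unfolding maps_to_iff by auto
  have "g A \<in> elts C" if "A \<in> elts B" for A
    using g[OF that] U P that equinumerous_numeral[OF s, of "g A"]
    unfolding C' is_union_def has_card_def by auto
  then have "is_function f B C" unfolding is_function_def m is_pair_iff f by auto
  moreover have "\<forall>A\<in>elts B. \<forall>v. maps_to f A v \<longrightarrow> elts v \<subseteq> elts A" using g m by simp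
  ultimately show "\<exists>\<A>. elts \<A> \<subseteq> elts F \<and> \<not> is_finite \<A> \<and>
         (\<exists>U C f. is_union \<A> U \<and> is_subsets_card s U C \<and> is_function f \<A> C \<and>
           (\<forall>A\<in>elts \<A>. \<forall>v. maps_to f A v \<longrightarrow> elts v \<subseteq> elts A))"
    using B(1,2) U C by (intro exI conjI)
qed

end

section \<open>Homogeneous sets\<close>

context ZF
begin

definition class_of :: "('a \<Rightarrow> 'a) \<Rightarrow> 'a \<Rightarrow> 'a \<Rightarrow> 'a" where
  "class_of \<kappa> y w = the_elt_of {v. v \<in> elts y \<and> \<kappa> v = \<kappa> w}"

lemma elts_class_of: assumes "definable_fun \<kappa>" shows "elts (class_of \<kappa> y w) = {v. v \<in> elts y \<and> \<kappa> v = \<kappa> w}"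
  unfolding class_of_def by (rule elts_sep) (intro definable_intros term_app1[OF assms])

lemma term_class_of: assumes "definable_fun \<kappa>" shows "definable_term t \<Longrightarrow> definable_term s \<Longrightarrow> definable_term (\<lambda>e. class_of \<kappa> (t e) (s e))"
  by (rule term_lift2) (unfold class_of_def, intro definable_intros term_app1[OF assms])

lemma is_finite_subset: "is_finite x \<Longrightarrow> elts y \<subseteq> elts x \<Longrightarrow> is_finite y"
  using internally_finite_subset[of "elts x" "elts y"] by simp

lemma is_finite_cover:
  assumes "definable_fun \<kappa>" "is_finite z" "\<And>w. w \<in> elts z \<Longrightarrow> is_finite (class_of \<kappa> y w)"
    and "elts S \<subseteq> elts y" "\<And>w. w \<in> elts S \<Longrightarrow> \<exists>v\<in>elts z. \<kappa> v = \<kappa> w"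
  shows "is_finite S"
proof -
  have "definable_fun (class_of \<kappa> y)" by (intro definable_funI term_class_of assms(1) definable_intros)
  then have "internally_finite (\<Union>w\<in>elts z. elts (class_of \<kappa> y w))"
    using assms(2,3) by (intro internally_finite_UN) auto
  moreover have "elts S \<subseteq> (\<Union>w\<in>elts z. elts (class_of \<kappa> y w))"
    using assms(4,5) by (fastforce simp: elts_class_of[OF assms(1)])
  ultimately show ?thesis using internally_finite_subset[of _ "elts S"] by simp
qed

lemma selects_subset: "selects k y \<phi> \<Longrightarrow> elts y' \<subseteq> elts y \<Longrightarrow> selects k y' \<phi>"
  unfolding selects_def by blast

end

locale six_selection = ZF mem for mem :: "'a \<Rightarrow> 'a \<Rightarrow> bool" +
  assumes six_select:
    "\<not> is_finite x \<Longrightarrow> \<exists>y \<phi>. elts y \<subseteq> elts x \<and> \<not> is_finite y \<and> selects 6 y \<phi>"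

locale homogeneous = six_selection mem for mem :: "'a \<Rightarrow> 'a \<Rightarrow> bool" +
  fixes \<kappa> \<phi> :: "'a \<Rightarrow> 'a" and y :: 'a and k :: nat
  assumes definable_fun_kappa: "definable_fun \<kappa>"
    and infinite_y: "\<not> is_finite y"
    and select_y: "selects 6 y \<phi>"
    and card_class_of: "w \<in> elts y \<Longrightarrow> has_card (elts (class_of \<kappa> y w)) k"
    and unsplittable: "elts z \<subseteq> elts y \<Longrightarrow> (\<And>w. w \<in> elts z \<Longrightarrow> \<exists>v\<in>elts y. v \<notin> elts z \<and> \<kappa> v = \<kappa> w)
      \<Longrightarrow> is_finite z"

context six_selection
begin

text \<open>In each class of \<open>y\<close> with more than six elements only the selected six are
  kept, the other classes are kept whole. Every class is still met, so a finite result would make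
  \<open>y\<close> a finite union of finite classes.\<close>

lemma small_classes_exist:
  assumes x: "\<not> is_finite x" and \<kappa>: "definable_fun \<kappa>" and fin: "\<And>w. w \<in> elts x \<Longrightarrow> is_finite (class_of \<kappa> x w)"
  shows "\<exists>z. elts z \<subseteq> elts x \<and> \<not> is_finite z \<and> (\<forall>w\<in>elts z. \<exists>j\<le>6. has_card (elts (class_of \<kappa> z w)) j)"
proof -
  note [simp] = elts_class_of[OF \<kappa>]
  obtain y \<phi> where y: "elts y \<subseteq> elts x" "\<not> is_finite y" and \<phi>: "selects 6 y \<phi>"
    using six_select[OF x] by blast
  have fin_y: "is_finite (class_of \<kappa> y w)" if "w \<in> elts y" for w
    using fin[of w] that y(1) by (intro is_finite_subset[of "class_of \<kappa> x w" "class_of \<kappa> y w"]) auto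
  have \<phi>_cls: "elts (\<phi> (class_of \<kappa> y w)) \<subseteq> elts (class_of \<kappa> y w) \<and> has_card (elts (\<phi> (class_of \<kappa> y w))) 6"
    if "w \<in> elts y" "exceeds 6 (elts (class_of \<kappa> y w))" for w
  proof -
    have "elts (class_of \<kappa> y w) \<subseteq> elts y" by auto
    then show ?thesis using \<phi> fin_y[OF that(1)] that(2) unfolding selects_def by blast
  qed
  have cong: "class_of \<kappa> y v = class_of \<kappa> y w" if "\<kappa> v = \<kappa> w" for v w
    unfolding class_of_def that ..
  define W where "W = the_elt_of {w. w \<in> elts y \<and> (exceeds 6 (elts (class_of \<kappa> y w)) \<longrightarrow> w \<in> elts (\<phi> (class_of \<kappa> y w)))}"
  have definable_fun\<phi>: "definable_fun \<phi>" using \<phi> unfolding selects_def by blast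
  have W: "elts W = {w. w \<in> elts y \<and> (exceeds 6 (elts (class_of \<kappa> y w)) \<longrightarrow> w \<in> elts (\<phi> (class_of \<kappa> y w)))}"
    unfolding W_def by (rule elts_sep) (intro definable_intros term_class_of[OF \<kappa>] term_app1[OF definable_fun\<phi>])
  have "\<not> is_finite W"
  proof
    assume "is_finite W"
    then have "is_finite y"
    proof (rule is_finite_cover[OF \<kappa>])
      show "is_finite (class_of \<kappa> y w)" if "w \<in> elts W" for w using that W fin_y by auto
      show "\<exists>v\<in>elts W. \<kappa> v = \<kappa> w" if w: "w \<in> elts y" for w
      proof (cases "exceeds 6 (elts (class_of \<kappa> y w))")
        case True
        then have "elts (\<phi> (class_of \<kappa> y w)) \<noteq> {}" using \<phi>_cls[OF w] unfolding has_card_def by auto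
        then obtain v where v: "v \<in> elts (\<phi> (class_of \<kappa> y w))" by blast
        then have "v \<in> elts (class_of \<kappa> y w)" using \<phi>_cls[OF w True] by blast
        then have "v \<in> elts y" "\<kappa> v = \<kappa> w" by auto
        then show ?thesis using W v cong[of v w] by auto
      qed (use w W in auto)
    qed simp
    then show False using y by simp
  qed
  moreover have "\<exists>j\<le>6. has_card (elts (class_of \<kappa> W w)) j" if w: "w \<in> elts W" for w
  proof -
    have W_iff: "v \<in> elts W \<longleftrightarrow> v \<in> elts y \<and> (exceeds 6 (elts (class_of \<kappa> y w)) \<longrightarrow> v \<in> elts (\<phi> (class_of \<kappa> y w)))"
      if "\<kappa> v = \<kappa> w" for v
      unfolding W mem_Collect_eq cong[OF that] ..
    show ?thesis
    proof (cases "exceeds 6 (elts (class_of \<kappa> y w))")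
      case True
      have wy: "w \<in> elts y" using w W by simp
      have "elts (class_of \<kappa> W w) = {v. v \<in> elts y \<and> \<kappa> v = \<kappa> w \<and> v \<in> elts (\<phi> (class_of \<kappa> y w))}"
        using True W_iff by auto
      also have "\<dots> = elts (\<phi> (class_of \<kappa> y w))" using \<phi>_cls[OF wy True] by auto
      finally show ?thesis using \<phi>_cls[OF wy True] by auto
    next
      case False
      have "elts (class_of \<kappa> W w) = elts (class_of \<kappa> y w)"
        using False W_iff by auto
      then show ?thesis using False unfolding exceeds_def has_card_def by (simp add: not_less)
    qed
  qed
  moreover have "elts W \<subseteq> elts x" using W y by auto
  ultimately show ?thesis by blast
qed

text \<open>The class size of a homogeneous set is the least bound on class sizes of infinite subsets.\<close>

lemma homogeneous_exists:
  assumes x: "\<not> is_finite x" and \<kappa>: "definable_fun \<kappa>" and fin: "\<And>w. w \<in> elts x \<Longrightarrow> is_finite (class_of \<kappa> x w)"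
  shows "\<exists>\<phi> y k. elts y \<subseteq> elts x \<and> k \<le> 6 \<and> homogeneous mem \<kappa> \<phi> y k"
proof -
  note [simp] = elts_class_of[OF \<kappa>]
  define bdd where "bdd k z \<longleftrightarrow> elts z \<subseteq> elts x \<and> \<not> is_finite z \<and>
      (\<forall>w\<in>elts z. \<exists>j\<le>k. has_card (elts (class_of \<kappa> z w)) j)" for k z
  \<comment> \<open>A minimum of HOL numbers, taken outside the model;
    \<open>small_classes_exist\<close> shows that 6 is a candidate.\<close>
  define k where "k = (LEAST k. \<exists>z. bdd k z)"
  have ex6: "\<exists>z. bdd 6 z" unfolding bdd_def by (rule small_classes_exist[OF assms])
  have k6: "k \<le> 6" unfolding k_def by (rule Least_le[where P="\<lambda>k. \<exists>z. bdd k z", OF ex6])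
  have "\<exists>z. bdd k z" unfolding k_def by (rule LeastI[where P="\<lambda>k. \<exists>z. bdd k z", OF ex6])
  then obtain z where z: "bdd k z" by blast
  have minimal: "is_finite z'" if "elts z' \<subseteq> elts x"
    and "\<And>w. w \<in> elts z' \<Longrightarrow> \<exists>j<k. has_card (elts (class_of \<kappa> z' w)) j" for z'
  proof (rule ccontr)
    assume inf: "\<not> is_finite z'"
    then have "elts z' \<noteq> {}" using internally_finite_empty internally_finite_elts by metis
    then have "k > 0" using that(2) by fastforce
    then have "bdd (k - 1) z'" unfolding bdd_def using that inf
      by (metis One_nat_def Suc_pred less_Suc_eq_le)
    then have "k \<le> k - 1" unfolding k_def by (intro Least_le) blast
    then show False using \<open>k > 0\<close> by simp
  qed
  obtain y \<phi> where y: "elts y \<subseteq> elts z" "\<not> is_finite y" and \<phi>: "selects 6 y \<phi>"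
    using six_select[of z] z unfolding bdd_def by blast
  have yx: "elts y \<subseteq> elts x" using y z unfolding bdd_def by blast
  have le: "\<exists>j\<le>k. has_card (elts (class_of \<kappa> y w)) j" if "w \<in> elts y" for w
  proof -
    have "finite (elts (class_of \<kappa> z w))" "card (elts (class_of \<kappa> z w)) \<le> k"
      using z that y(1) unfolding bdd_def has_card_def by auto
    moreover have "elts (class_of \<kappa> y w) \<subseteq> elts (class_of \<kappa> z w)" using y(1) by auto
    ultimately show ?thesis unfolding has_card_def
      by (metis card_mono finite_subset le_trans)
  qed
  have cong: "class_of \<kappa> y v = class_of \<kappa> y w" if "\<kappa> v = \<kappa> w" for v w
    unfolding class_of_def that ..
  \<comment> \<open>Passing to \<open>y\<close> may have shrunk some classes below \<open>k\<close>.
    They make up \<open>y0\<close>, which is finite by minimality of \<open>k\<close>, so discarding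
    it leaves an infinite set.\<close>
  define y1 where "y1 = the_elt_of {w. w \<in> elts y \<and> has_card (elts (class_of \<kappa> y w)) k}"
  have y1: "elts y1 = {w. w \<in> elts y \<and> has_card (elts (class_of \<kappa> y w)) k}"
    unfolding y1_def by (rule elts_sep) (intro definable_intros term_class_of[OF \<kappa>])
  define y0 where "y0 = the_elt_of {w. w \<in> elts y \<and> \<not> has_card (elts (class_of \<kappa> y w)) k}"
  have y0: "elts y0 = {w. w \<in> elts y \<and> \<not> has_card (elts (class_of \<kappa> y w)) k}"
    unfolding y0_def by (rule elts_sep) (intro definable_intros term_class_of[OF \<kappa>])
  have cls1: "class_of \<kappa> y1 w = class_of \<kappa> y w" if "w \<in> elts y1" for w
  proof (rule extensionality, rule set_eqI)
    fix v
    have "\<kappa> v = \<kappa> w \<Longrightarrow> class_of \<kappa> y v = class_of \<kappa> y w" by (rule cong)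
    then show "v \<in> elts (class_of \<kappa> y1 w) \<longleftrightarrow> v \<in> elts (class_of \<kappa> y w)"
      using that unfolding y1 elts_class_of[OF \<kappa>, of y1] elts_class_of[OF \<kappa>, of y] mem_Collect_eq by metis
  qed
  have cls0: "class_of \<kappa> y0 w = class_of \<kappa> y w" if "w \<in> elts y0" for w
  proof (rule extensionality, rule set_eqI)
    fix v
    have "\<kappa> v = \<kappa> w \<Longrightarrow> class_of \<kappa> y v = class_of \<kappa> y w" by (rule cong)
    then show "v \<in> elts (class_of \<kappa> y0 w) \<longleftrightarrow> v \<in> elts (class_of \<kappa> y w)"
      using that unfolding y0 elts_class_of[OF \<kappa>, of y0] elts_class_of[OF \<kappa>, of y] mem_Collect_eq by metis
  qed
  have "is_finite y0"
  proof (rule minimal)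
    show "elts y0 \<subseteq> elts x" using y0 yx by auto
    fix w assume w: "w \<in> elts y0"
    then have "w \<in> elts y" "\<not> has_card (elts (class_of \<kappa> y w)) k" unfolding y0 by blast+
    then show "\<exists>j<k. has_card (elts (class_of \<kappa> y0 w)) j"
      using le[of w] unfolding cls0[OF w] by (metis le_neq_implies_less)
  qed
  have inf1: "\<not> is_finite y1"
  proof
    assume "is_finite y1"
    then have "internally_finite (elts y1 \<union> elts y0)" using \<open>is_finite y0\<close> by (intro internally_finite_Un) auto
    moreover have "elts y1 \<union> elts y0 = elts y" unfolding y1 y0 by blast
    ultimately show False using y by simp
  qed
  have "homogeneous mem \<kappa> \<phi> y1 k"
  proof unfold_locales
    show "definable_fun \<kappa>" by fact
    show "\<not> is_finite y1" by fact
    show "selects 6 y1 \<phi>" by (rule selects_subset[OF \<phi>]) (auto simp: y1)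
    show "has_card (elts (class_of \<kappa> y1 w)) k" if "w \<in> elts y1" for w
      using cls1[OF that] that y1 by simp
    fix z' assume sub: "elts z' \<subseteq> elts y1"
      and proper: "\<And>w. w \<in> elts z' \<Longrightarrow> \<exists>v\<in>elts y1. v \<notin> elts z' \<and> \<kappa> v = \<kappa> w"
    show "is_finite z'"
    proof (rule minimal)
      show "elts z' \<subseteq> elts x" using sub y1 yx by auto
      fix w assume w: "w \<in> elts z'"
      \<comment> \<open>A proper part of a class with \<open>k\<close> elements has fewer than
        \<open>k\<close> elements, so minimality forces \<open>z'\<close> to be finite.\<close>
      have "elts (class_of \<kappa> z' w) \<subset> elts (class_of \<kappa> y1 w)" using sub proper[OF w] by auto
      moreover have "w \<in> elts y1" using w sub by blast
      then have "has_card (elts (class_of \<kappa> y1 w)) k"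
        unfolding cls1[OF \<open>w \<in> elts y1\<close>] unfolding y1 by blast
      ultimately show "\<exists>j<k. has_card (elts (class_of \<kappa> z' w)) j"
        unfolding has_card_def by (metis finite_subset psubset_card_mono psubset_imp_subset)
    qed
  qed
  then show ?thesis using k6 yx y1 by blast
qed

end

context homogeneous
begin

lemma elts_class_of_y: "elts (class_of \<kappa> z w) = {v. v \<in> elts z \<and> \<kappa> v = \<kappa> w}"
  by (rule elts_class_of[OF definable_fun_kappa])

lemma term_kappa: "definable_term t \<Longrightarrow> definable_term (\<lambda>e. \<kappa> (t e))"
  by (rule term_app1[OF definable_fun_kappa])

lemma term_phi: "definable_term t \<Longrightarrow> definable_term (\<lambda>e. \<phi> (t e))"
  using select_y unfolding selects_def by (blast intro: term_app1)

lemma term_class_of_kappa: "definable_term t \<Longrightarrow> definable_term s \<Longrightarrow> definable_term (\<lambda>e. class_of \<kappa> (t e) (s e))"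
  by (rule term_class_of[OF definable_fun_kappa])

lemma is_finite_class_of: "w \<in> elts y \<Longrightarrow> is_finite (class_of \<kappa> y w)"
  using card_class_of[of w] internally_finite_finite[of "elts (class_of \<kappa> y w)"] unfolding has_card_def by simp

lemma cover_finite:
  assumes "is_finite z" "elts z \<subseteq> elts y" "elts S \<subseteq> elts y"
    and "\<And>w. w \<in> elts S \<Longrightarrow> \<exists>v\<in>elts z. \<kappa> v = \<kappa> w"
  shows "is_finite S"
  by (rule is_finite_cover[OF definable_fun_kappa assms(1) _ assms(3,4)]) (use assms(2) is_finite_class_of in auto)

text \<open>The points satisfying \<open>P\<close> in the classes that \<open>P\<close> splits form
  proper parts of classes. Homogeneity makes them finite, and they meet every class represented in
  \<open>S\<close>.\<close>

lemma split_finite: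
  assumes "definable (\<lambda>e. P (e 0))" "elts S \<subseteq> elts y"
    and "\<And>w. w \<in> elts S \<Longrightarrow> \<exists>v\<in>elts y. \<kappa> v = \<kappa> w \<and> P v"
    and "\<And>w. w \<in> elts S \<Longrightarrow> \<exists>v\<in>elts y. \<kappa> v = \<kappa> w \<and> \<not> P v"
  shows "is_finite S"
proof -
  define z where "z = the_elt_of {v. v \<in> elts y \<and> P v \<and> (\<exists>u\<in>elts y. \<kappa> u = \<kappa> v \<and> \<not> P u)}"
  have z: "elts z = {v. v \<in> elts y \<and> P v \<and> (\<exists>u\<in>elts y. \<kappa> u = \<kappa> v \<and> \<not> P u)}"
    unfolding z_def by (rule elts_sep) (intro definable_intros term_kappa definable_app1[OF assms(1)])
  have "is_finite z" by (rule unsplittable) (auto simp: z)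
  then show ?thesis
  proof (rule cover_finite)
    fix w assume "w \<in> elts S"
    then show "\<exists>v\<in>elts z. \<kappa> v = \<kappa> w" using assms(3,4)[of w] unfolding z by fastforce
  qed (use assms(2) z in auto)
qed

text \<open>Allows a contradiction derived for all classes to be used against any infinite union of
  classes.\<close>

lemma homogeneous_subset:
  assumes "elts S \<subseteq> elts y" "\<not> is_finite S" "\<And>w v. w \<in> elts S \<Longrightarrow> v \<in> elts y \<Longrightarrow> \<kappa> v = \<kappa> w \<Longrightarrow> v \<in> elts S"
  shows "homogeneous mem \<kappa> \<phi> S k"
proof unfold_locales
  show "definable_fun \<kappa>" by (rule definable_fun_kappa)
  show "\<not> is_finite S" by fact
  show "selects 6 S \<phi>" by (rule selects_subset[OF select_y assms(1)])
  show "has_card (elts (class_of \<kappa> S w)) k" if "w \<in> elts S" for w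
  proof -
    have "elts (class_of \<kappa> S w) = elts (class_of \<kappa> y w)" using assms(1,3) that unfolding elts_class_of_y by blast
    then show ?thesis using card_class_of[of w] assms(1) that by auto
  qed
  show "is_finite z" if "elts z \<subseteq> elts S" "\<And>w. w \<in> elts z \<Longrightarrow> \<exists>v\<in>elts S. v \<notin> elts z \<and> \<kappa> v = \<kappa> w" for z
    by (rule unsplittable) (use that assms(1) in blast)+
qed

end

section \<open>Chains and tournaments of classes\<close>

context homogeneous
begin

definition partial_selector :: "'a \<Rightarrow> bool" where
  "partial_selector h \<longleftrightarrow> elts h \<subseteq> elts y \<and> (\<forall>w\<in>elts h. \<forall>v\<in>elts h. \<kappa> v = \<kappa> w \<longrightarrow> v = w)"

lemma definable_partial_selector: "definable_term t \<Longrightarrow> definable (\<lambda>e. partial_selector (t e))"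
  by (rule definable_lift1) (unfold partial_selector_def, intro definable_intros term_kappa)

text \<open>Finite choice inside the model. A choice made in HOL would not be an element of the
  model, so the selector is built by internal induction.\<close>

lemma selector_exists:
  assumes "is_finite D" "elts D \<subseteq> elts y"
  shows "\<exists>h. partial_selector h \<and> elts h \<subseteq> elts D \<and> (\<forall>w\<in>elts D. \<exists>v\<in>elts h. \<kappa> v = \<kappa> w)"
proof -
  have "elts D \<subseteq> elts y \<longrightarrow>
    (\<exists>h. partial_selector h \<and> elts h \<subseteq> elts D \<and> (\<forall>w\<in>elts D. \<exists>v\<in>elts h. \<kappa> v = \<kappa> w))"
    using assms(1)
  proof (induction D rule: is_finite_induct)
    case definable
    show ?case by (intro definable_intros term_kappa definable_partial_selector)
  next
    case empty
    show ?case by (intro impI exI[of _ "the_elt_of {}"]) (simp add: partial_selector_def)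
  next
    case (adjoin a D)
    show ?case
    proof
      assume sub: "elts (adjoin a D) \<subseteq> elts y"
      then obtain h where h: "partial_selector h" "elts h \<subseteq> elts D" "\<And>w. w \<in> elts D \<Longrightarrow> \<exists>v\<in>elts h. \<kappa> v = \<kappa> w"
        using adjoin by auto
      show "\<exists>h. partial_selector h \<and> elts h \<subseteq> elts (adjoin a D) \<and>
          (\<forall>w\<in>elts (adjoin a D). \<exists>v\<in>elts h. \<kappa> v = \<kappa> w)"
      proof (cases "\<exists>v\<in>elts h. \<kappa> v = \<kappa> a")
        case True
        then show ?thesis using h by (intro exI[of _ h]) auto
      next
        case False
        then have "partial_selector (adjoin a h)"
          using h(1) sub unfolding partial_selector_def by (auto; metis)
        then show ?thesis using h by (intro exI[of _ "adjoin a h"]) auto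
      qed
    qed
  qed
  then show ?thesis using assms(2) by blast
qed

text \<open>For a partial selector this is its domain, represented as the union of the classes in
  which it chooses a point.\<close>

definition saturate :: "'a \<Rightarrow> 'a" where
  "saturate h = the_elt_of {v. v \<in> elts y \<and> (\<exists>w\<in>elts h. \<kappa> w = \<kappa> v)}"

lemma term_saturate: "definable_term t \<Longrightarrow> definable_term (\<lambda>e. saturate (t e))"
  by (rule term_lift1) (unfold saturate_def, intro definable_intros term_kappa)

lemma elts_saturate: "elts (saturate h) = {v. v \<in> elts y \<and> (\<exists>w\<in>elts h. \<kappa> w = \<kappa> v)}"
  unfolding saturate_def by (rule elts_sep) (intro definable_intros term_kappa)

text \<open>
  Apply the principle to the selectors of the members of the chain. In a homogeneous set of
  selectors, a given class is treated alike by all selectors with the same domain, for all but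
  finitely many of them; so the least domain for which this happens chooses one point of each class.
\<close>

lemma no_infinite_chain:
  assumes k: "1 < k"
    and fin: "\<And>D. D \<in> elts \<D> \<Longrightarrow> is_finite D"
    and sub: "\<And>D. D \<in> elts \<D> \<Longrightarrow> elts D \<subseteq> elts y"
    and sat: "\<And>D w v. D \<in> elts \<D> \<Longrightarrow> w \<in> elts D \<Longrightarrow> v \<in> elts y \<Longrightarrow> \<kappa> v = \<kappa> w \<Longrightarrow> v \<in> elts D"
    and chain: "\<And>D D'. D \<in> elts \<D> \<Longrightarrow> D' \<in> elts \<D> \<Longrightarrow> elts D \<subseteq> elts D' \<or> elts D' \<subseteq> elts D"
  shows "internally_finite (\<Union>D\<in>elts \<D>. elts D)"
proof (rule ccontr)
  assume inf: "\<not> internally_finite (\<Union>D\<in>elts \<D>. elts D)"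
  note dfns = definable_intros term_kappa term_saturate definable_partial_selector
  have definable_fun_sat: "definable_fun saturate" by (intro definable_funI dfns)
  define X where "X = the_elt_of {h. partial_selector h \<and> saturate h \<in> elts \<D>}"
  have "small {h. partial_selector h \<and> saturate h \<in> elts \<D>}"
    by (rule small_subset[OF small_Pow[OF small_elts[of y]]])
       (auto simp: partial_selector_def intro!: dfns)
  then have X: "elts X = {h. partial_selector h \<and> saturate h \<in> elts \<D>}"
    unfolding X_def by (rule elts_the_elt_of)
  have sub_sat: "elts h \<subseteq> elts (saturate h)" if "h \<in> elts X" for h
    using that unfolding X partial_selector_def elts_saturate by auto
  \<comment> \<open>Every member of the chain is the domain of some selector, so a finite
    \<open>X\<close> would leave only finitely many domains, each finite.\<close>
  have X_inf: "\<not> is_finite X"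
  proof
    assume "is_finite X"
    then have "internally_finite (saturate ` elts X)" by (intro internally_finite_image definable_fun_sat) simp
    moreover have "saturate ` elts X = elts \<D>"
    proof (intro equalityI subsetI)
      fix D assume D: "D \<in> elts \<D>"
      obtain h where h: "partial_selector h" "elts h \<subseteq> elts D" "\<forall>w\<in>elts D. \<exists>v\<in>elts h. \<kappa> v = \<kappa> w"
        using selector_exists[OF fin[OF D] sub[OF D]] by blast
      have "saturate h = D"
        using h(2,3) sat[OF D] sub[OF D] unfolding elts_inject[symmetric] elts_saturate by fastforce
      then show "D \<in> saturate ` elts X" using h(1) D X by auto
    qed (auto simp: X)
    ultimately have "internally_finite (\<Union>D\<in>elts \<D>. elts D)" using fin by (intro internally_finite_Union) auto
    then show False using inf by simp
  qed
  \<comment> \<open>Selectors with a common domain are subsets of that domain, hence members of a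
    finite power set.\<close>
  have "is_finite (class_of saturate X h)" if h: "h \<in> elts X" for h
  proof -
    have "internally_finite {z. elts z \<subseteq> elts (saturate h)}" using h fin X by (intro internally_finite_Pow) auto
    moreover have "elts (class_of saturate X h) \<subseteq> {z. elts z \<subseteq> elts (saturate h)}"
      using sub_sat unfolding elts_class_of[OF definable_fun_sat] by fastforce
    ultimately show ?thesis using internally_finite_subset[of _ "elts (class_of saturate X h)"] by simp
  qed
  then obtain \<psi> x j where x: "elts x \<subseteq> elts X" and hom: "homogeneous mem saturate \<psi> x j"
    using homogeneous_exists[OF X_inf definable_fun_sat] by blast
  interpret H: homogeneous mem saturate \<psi> x j by (rule hom)
  have sel: "partial_selector h" "saturate h \<in> elts \<D>" "elts h \<subseteq> elts (saturate h)" if "h \<in> elts x" for h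
    using that x X sub_sat by auto
  \<comment> \<open>The first conjunct excludes domains that no selector in \<open>x\<close> has, on
    which agreement would be vacuous.\<close>
  define agree where "agree D b \<longleftrightarrow>
    (\<exists>h\<in>elts x. saturate h = D) \<and> (\<forall>h\<in>elts x. saturate h = D \<longrightarrow> b \<in> elts h)" for D b
  have definable_agree: "definable (\<lambda>e. agree (t e) (s e))" if "definable_term t" "definable_term s" for t s
    by (rule definable_lift2[OF _ that]) (unfold agree_def, intro dfns)
  have agreement: "\<exists>D\<in>elts \<D>. \<exists>b\<in>elts y. \<kappa> b = \<kappa> b0 \<and> agree D b"
    if D0: "D0 \<in> elts \<D>" "b0 \<in> elts D0" for D0 b0
  proof (rule ccontr)
    assume no: "\<not> (\<exists>D\<in>elts \<D>. \<exists>b\<in>elts y. \<kappa> b = \<kappa> b0 \<and> agree D b)"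
    \<comment> \<open>\<open>T b\<close> collects the selectors that choose \<open>b\<close>
      although another one with the same domain does not. It misses a part of each group of
      selectors that it meets, so homogeneity of \<open>x\<close> makes it finite.\<close>
    define T where "T b = the_elt_of {h. h \<in> elts x \<and> b \<in> elts h \<and> (\<exists>h'\<in>elts x. saturate h' = saturate h \<and> b \<notin> elts h')}" for b
    have T: "elts (T b) = {h. h \<in> elts x \<and> b \<in> elts h \<and> (\<exists>h'\<in>elts x. saturate h' = saturate h \<and> b \<notin> elts h')}" for b
      unfolding T_def by (rule elts_sep) (intro dfns)
    have "definable_fun T" unfolding T_def by (intro definable_funI dfns)
    have "is_finite (T b)" for b by (rule H.unsplittable) (auto simp: T)
    moreover have b0: "b0 \<in> elts y" using D0 sub by auto
    ultimately have "internally_finite (\<Union>b\<in>elts (class_of \<kappa> y b0). elts (T b))"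
      using is_finite_class_of by (intro internally_finite_UN \<open>definable_fun T\<close>) auto
    then have "internally_finite ((\<Union>b\<in>elts (class_of \<kappa> y b0). elts (T b)) \<union> {z. elts z \<subseteq> elts D0})"
      using fin D0 by (intro internally_finite_Un internally_finite_Pow) auto
    \<comment> \<open>Without agreement, a selector whose domain contains \<open>b0\<close> lies in
      \<open>T b\<close> for its own choice \<open>b\<close>. Any other domain is below
      \<open>D0\<close> by comparability, which leaves finitely many selectors.\<close>
    moreover have "elts x \<subseteq> (\<Union>b\<in>elts (class_of \<kappa> y b0). elts (T b)) \<union> {z. elts z \<subseteq> elts D0}"
    proof
      fix h assume h: "h \<in> elts x"
      show "h \<in> (\<Union>b\<in>elts (class_of \<kappa> y b0). elts (T b)) \<union> {z. elts z \<subseteq> elts D0}"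
      proof (cases "b0 \<in> elts (saturate h)")
        case True
        then obtain b where b: "b \<in> elts h" "\<kappa> b = \<kappa> b0" unfolding elts_saturate by auto
        then have "b \<in> elts y" using sel(1)[OF h] unfolding partial_selector_def by auto
        then have "\<not> agree (saturate h) b" using no sel(2)[OF h] b by auto
        then have "h \<in> elts (T b)" unfolding agree_def T using h b by auto
        then show ?thesis using b \<open>b \<in> elts y\<close> unfolding elts_class_of_y by auto
      next
        case False
        then have "elts (saturate h) \<subseteq> elts D0" using chain[OF sel(2)[OF h] D0(1)] D0(2) by auto
        then show ?thesis using sel(3)[OF h] by auto
      qed
    qed
    ultimately have "is_finite x" using internally_finite_subset[of _ "elts x"] by simp
    then show False using H.infinite_y by simp
  qed
  \<comment> \<open>Keeps the points agreed upon at the least domain where any point of their class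
    is. Comparability makes this domain unique, and a selector contains only one point of the
    class.\<close>
  define y' where "y' = the_elt_of {b. b \<in> elts y \<and> (\<exists>D\<in>elts \<D>. agree D b \<and>
     (\<forall>D'\<in>elts \<D>. (\<exists>b'\<in>elts y. \<kappa> b' = \<kappa> b \<and> agree D' b') \<longrightarrow> \<not> (elts D' \<subseteq> elts D \<and> D' \<noteq> D)))}"
  have y': "elts y' = {b. b \<in> elts y \<and> (\<exists>D\<in>elts \<D>. agree D b \<and>
     (\<forall>D'\<in>elts \<D>. (\<exists>b'\<in>elts y. \<kappa> b' = \<kappa> b \<and> agree D' b') \<longrightarrow> \<not> (elts D' \<subseteq> elts D \<and> D' \<noteq> D)))}"
    unfolding y'_def by (rule elts_sep) (intro dfns definable_agree)
  have unique: "b = v" if b: "b \<in> elts y'" and v: "v \<in> elts y'" and bv: "\<kappa> v = \<kappa> b" for b v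
  proof -
    obtain D where D: "D \<in> elts \<D>" "agree D b"
      "\<And>D' b'. D' \<in> elts \<D> \<Longrightarrow> b' \<in> elts y \<Longrightarrow> \<kappa> b' = \<kappa> b \<Longrightarrow> agree D' b' \<Longrightarrow> \<not> (elts D' \<subseteq> elts D \<and> D' \<noteq> D)"
      using b unfolding y' by blast
    obtain E where E: "E \<in> elts \<D>" "agree E v"
      "\<And>D' b'. D' \<in> elts \<D> \<Longrightarrow> b' \<in> elts y \<Longrightarrow> \<kappa> b' = \<kappa> v \<Longrightarrow> agree D' b' \<Longrightarrow> \<not> (elts D' \<subseteq> elts E \<and> D' \<noteq> E)"
      using v unfolding y' by blast
    have "b \<in> elts y" "v \<in> elts y" using b v unfolding y' by blast+
    then have "D = E" using chain[OF D(1) E(1)] D(3)[OF E(1) _ bv E(2)] E(3)[OF D(1) _ bv[symmetric] D(2)] by metis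
    obtain h where "h \<in> elts x" "saturate h = D" using D(2) unfolding agree_def by blast
    then have "b \<in> elts h" "v \<in> elts h" "partial_selector h"
      using D(2) E(2) \<open>D = E\<close> sel(1) unfolding agree_def by auto
    then show ?thesis using bv unfolding partial_selector_def by metis
  qed
  have "is_finite y'"
  proof (rule unsplittable)
    show "elts y' \<subseteq> elts y" using y' by auto
    fix w assume w: "w \<in> elts y'"
    then have "w \<in> elts y" unfolding y' by blast
    then have card: "card (elts (class_of \<kappa> y w)) = k" using card_class_of[of w] unfolding has_card_def by blast
    \<comment> \<open>Here 1 < \<open>k\<close> enters: a single point is a proper part of its
      class.\<close>
    have "\<exists>v\<in>elts (class_of \<kappa> y w). v \<noteq> w"
    proof (rule ccontr)
      assume "\<not> ?thesis"
      then have "elts (class_of \<kappa> y w) \<subseteq> {w}" by blast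
      then have "card (elts (class_of \<kappa> y w)) \<le> card {w}" by (intro card_mono) auto
      then show False using k card by simp
    qed
    then obtain v where "v \<in> elts y" "\<kappa> v = \<kappa> w" "v \<noteq> w" unfolding elts_class_of_y by blast
    then show "\<exists>v\<in>elts y. v \<notin> elts y' \<and> \<kappa> v = \<kappa> w" using unique[OF w, of v] by auto
  qed
  obtain U where U: "elts U = (\<Union>D\<in>elts \<D>. elts D)"
    using small_Union[OF small_elts] unfolding small_def by blast
  have "is_finite U"
  proof (rule cover_finite[OF \<open>is_finite y'\<close>])
    show "elts y' \<subseteq> elts y" using y' by auto
    show "elts U \<subseteq> elts y" using U sub by auto
    fix b0 assume "b0 \<in> elts U"
    then obtain D0 where D0: "D0 \<in> elts \<D>" "b0 \<in> elts D0" unfolding U by blast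
    obtain D1 b1 where D1: "D1 \<in> elts \<D>" "b1 \<in> elts y" "\<kappa> b1 = \<kappa> b0" "agree D1 b1"
      using agreement[OF D0] by blast
    \<comment> \<open>Only domains below \<open>D1\<close> are considered; they form an internally
      finite set, which has a minimal element.\<close>
    define \<M> where "\<M> = {D. D \<in> elts \<D> \<and> elts D \<subseteq> elts D1 \<and> (\<exists>b\<in>elts y. \<kappa> b = \<kappa> b0 \<and> agree D b)}"
    have "internally_finite \<M>"
    proof (rule internally_finite_subset)
      show "internally_finite {z. elts z \<subseteq> elts D1}" using fin D1 by (intro internally_finite_Pow) auto
      show "\<M> \<subseteq> {z. elts z \<subseteq> elts D1}" unfolding \<M>_def by blast
      show "small \<M>" unfolding \<M>_def by (rule small_sep) (intro dfns definable_agree)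
    qed
    moreover have "D1 \<in> \<M>" unfolding \<M>_def using D1 by blast
    ultimately obtain D where D: "D \<in> \<M>" "\<forall>D'\<in>\<M>. \<not> elts D' \<subset> elts D" using internally_finite_minimal[of \<M>] by blast
    then obtain b where b: "b \<in> elts y" "\<kappa> b = \<kappa> b0" "agree D b" unfolding \<M>_def by blast
    have "\<not> (elts D' \<subseteq> elts D \<and> D' \<noteq> D)"
      if D': "D' \<in> elts \<D>" "b' \<in> elts y" "\<kappa> b' = \<kappa> b" "agree D' b'" for D' b'
    proof
      assume *: "elts D' \<subseteq> elts D \<and> D' \<noteq> D"
      then have "D' \<in> \<M>" using D' b(2) D(1) unfolding \<M>_def by auto
      then show False using D(2) * by (auto simp: psubset_eq)
    qed
    then have "b \<in> elts y'" using b(1,3) D(1) unfolding y' \<M>_def by blast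
    then show "\<exists>v\<in>elts y'. \<kappa> v = \<kappa> b0" using b(2) by blast
  qed
  then show False using inf U internally_finite_elts by metis
qed

text \<open>
  If all sets of points reachable along \<open>R\<close> are finite, then they form a chain. Otherwise the
  iterated images of a single class do.
\<close>

lemma no_locally_finite_tournament:
  assumes k: "1 < k"
    and R: "definable (\<lambda>e. R (e 0) (e 1))"
    and refl: "\<And>w v. w \<in> elts y \<Longrightarrow> v \<in> elts y \<Longrightarrow> \<kappa> v = \<kappa> w \<Longrightarrow> R w v"
    and sat: "\<And>w v v'. w \<in> elts y \<Longrightarrow> v \<in> elts y \<Longrightarrow> R w v \<Longrightarrow> v' \<in> elts y \<Longrightarrow> \<kappa> v' = \<kappa> v \<Longrightarrow> R w v'"
    and total: "\<And>w v. w \<in> elts y \<Longrightarrow> v \<in> elts y \<Longrightarrow> R w v \<or> R v w"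
    and fin: "\<And>w. w \<in> elts y \<Longrightarrow> internally_finite {v. v \<in> elts y \<and> R w v}"
  shows False
proof -
  note dfns = definable_intros term_kappa definable_app2[of R, OF R] term_class_of_kappa
  \<comment> \<open>An intersection of closed sets replaces recursion: iterating over HOL numbers
    would stop at standard stages and need not produce a set of the model.\<close>
  define reach where "reach w = the_elt_of {v. v \<in> elts y \<and> (\<forall>C. elts C \<subseteq> elts y \<and> w \<in> elts C \<and>
      (\<forall>u\<in>elts C. \<forall>v\<in>elts y. R u v \<longrightarrow> v \<in> elts C) \<longrightarrow> v \<in> elts C)}" for w
  have reach: "elts (reach w) = {v. v \<in> elts y \<and> (\<forall>C. elts C \<subseteq> elts y \<and> w \<in> elts C \<and>
      (\<forall>u\<in>elts C. \<forall>v\<in>elts y. R u v \<longrightarrow> v \<in> elts C) \<longrightarrow> v \<in> elts C)}" for w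
    unfolding reach_def by (rule elts_sep) (intro dfns)
  have definable_fun_reach: "definable_fun reach" unfolding reach_def by (intro definable_funI dfns)
  have reach_refl: "w \<in> elts (reach w)" if "w \<in> elts y" for w using that unfolding reach by blast
  have reach_sub: "elts (reach w) \<subseteq> elts y" for w unfolding reach by blast
  have reach_step: "v \<in> elts (reach w)" if "u \<in> elts (reach w)" "v \<in> elts y" "R u v" for u v w
    using that unfolding reach by blast
  have reach_least: "elts (reach w) \<subseteq> elts C"
    if "elts C \<subseteq> elts y" "w \<in> elts C" "\<And>u v. u \<in> elts C \<Longrightarrow> v \<in> elts y \<Longrightarrow> R u v \<Longrightarrow> v \<in> elts C" for w C
    using that unfolding reach by blast
  have reach_mono: "elts (reach v) \<subseteq> elts (reach w)" if "v \<in> elts (reach w)" for v w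
    using reach_sub that reach_step by (rule reach_least)
  show False
  proof (cases "\<forall>w\<in>elts y. is_finite (reach w)")
    case True
    have "small (reach ` elts y)"
      by (rule small_image[OF small_elts]) (intro term_app1[OF definable_fun_reach] dfns)
    then obtain \<D> where \<D>: "elts \<D> = reach ` elts y" by (metis smallE)
    have "internally_finite (\<Union>D\<in>elts \<D>. elts D)"
    proof (rule no_infinite_chain[OF k])
      show "elts D \<subseteq> elts D' \<or> elts D' \<subseteq> elts D" if DD: "D \<in> elts \<D>" "D' \<in> elts \<D>" for D D'
      proof -
        obtain w v where wv: "w \<in> elts y" "v \<in> elts y" "D = reach w" "D' = reach v"
          using DD unfolding \<D> by blast
        \<comment> \<open>Totality puts one of the two points into the set reachable from the other,
          and reachability is transitive.\<close>
        then show ?thesis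
          using total[OF wv(1,2)] reach_step reach_refl reach_mono by metis
      qed
      show "v \<in> elts D" if D: "D \<in> elts \<D>" "w \<in> elts D" "v \<in> elts y" "\<kappa> v = \<kappa> w" for D w v
      proof -
        obtain u where "D = reach u" using D(1) unfolding \<D> by blast
        then show ?thesis using reach_step D(2-4) reach_sub refl by blast
      qed
    qed (use True reach_sub \<D> in auto)
    moreover have "(\<Union>D\<in>elts \<D>. elts D) = elts y" using \<D> reach_sub reach_refl by auto
    ultimately show False using infinite_y by simp
  next
    case False
    then obtain w0 where w0: "w0 \<in> elts y" and inf: "\<not> is_finite (reach w0)" by blast
    define out where "out C = the_elt_of {v. v \<in> elts y \<and> (\<exists>w\<in>elts C. R w v)}" for C
    have out: "elts (out C) = {v. v \<in> elts y \<and> (\<exists>w\<in>elts C. R w v)}" for C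
      unfolding out_def by (rule elts_sep) (intro dfns)
    have definable_fun_out: "definable_fun out" unfolding out_def by (intro definable_funI dfns)
    have out_mono: "elts C \<subseteq> elts D \<Longrightarrow> elts (out C) \<subseteq> elts (out D)" for C D unfolding out by blast
    define C0 where "C0 = class_of \<kappa> y w0"
    \<comment> \<open>The iterates of \<open>out\<close> on \<open>C0\<close>, again as the least
      collection closed under the operation, so nonstandard stages are included.\<close>
    define \<C> where "\<C> = the_elt_of {C. elts C \<subseteq> elts y \<and> (\<forall>P. C0 \<in> elts P \<and> (\<forall>C\<in>elts P. out C \<in> elts P) \<longrightarrow> C \<in> elts P)}"
    have "small {C. elts C \<subseteq> elts y \<and> (\<forall>P. C0 \<in> elts P \<and> (\<forall>C\<in>elts P. out C \<in> elts P) \<longrightarrow> C \<in> elts P)}"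
      by (rule small_subset[OF small_Pow[OF small_elts[of y]]])
         (blast, intro dfns term_app1[OF definable_fun_out])
    then have \<C>: "elts \<C> = {C. elts C \<subseteq> elts y \<and> (\<forall>P. C0 \<in> elts P \<and> (\<forall>C\<in>elts P. out C \<in> elts P) \<longrightarrow> C \<in> elts P)}"
      unfolding \<C>_def by (rule elts_the_elt_of)
    have "elts C0 \<subseteq> elts y" unfolding C0_def elts_class_of_y by blast
    then have C0: "C0 \<in> elts \<C>" unfolding \<C> by blast
    have out_sub: "elts (out C) \<subseteq> elts y" for C unfolding out by blast
    have out_in: "out C \<in> elts \<C>" if "C \<in> elts \<C>" for C
      using that out_sub unfolding \<C> mem_Collect_eq by simp
    have induct: "Q C" if C: "C \<in> elts \<C>" and Q: "definable (\<lambda>e. Q (e 0))" "Q C0"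
      "\<And>C. C \<in> elts \<C> \<Longrightarrow> Q C \<Longrightarrow> Q (out C)" for Q C
    proof -
      define P where "P = the_elt_of {C. C \<in> elts \<C> \<and> Q C}"
      have P: "elts P = {C. C \<in> elts \<C> \<and> Q C}" unfolding P_def by (rule elts_sep) (intro dfns definable_app1[OF Q(1)])
      have "C0 \<in> elts P \<and> (\<forall>C\<in>elts P. out C \<in> elts P)" using P Q(2,3) C0 out_in by simp
      then have "C \<in> elts P" using C unfolding \<C> by blast
      then show ?thesis using P by simp
    qed
    have sub: "elts C \<subseteq> elts y" if "C \<in> elts \<C>" for C using that unfolding \<C> by blast
    have infl: "elts C \<subseteq> elts (out C)" if "C \<in> elts \<C>" for C
      using sub[OF that] refl unfolding out by blast
    have finC: "is_finite C" if "C \<in> elts \<C>" for C using that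
    proof (rule induct)
      show "is_finite C0" unfolding C0_def by (rule is_finite_class_of[OF w0])
      fix C assume C: "C \<in> elts \<C>" "is_finite C"
      define g where "g w = the_elt_of {v. v \<in> elts y \<and> R w v}" for w
      have g: "elts (g w) = {v. v \<in> elts y \<and> R w v}" for w
        unfolding g_def by (rule elts_sep) (intro dfns)
      have "internally_finite (\<Union>w\<in>elts C. elts (g w))"
      proof (rule internally_finite_UN)
        show "definable_fun g" unfolding g_def by (intro definable_funI dfns)
      qed (use C sub fin g in auto)
      moreover have "elts (out C) = (\<Union>w\<in>elts C. elts (g w))" unfolding out g by blast
      ultimately show "is_finite (out C)" using internally_finite_elts by metis
    qed (intro dfns)
    have satC: "\<forall>w\<in>elts C. \<forall>v\<in>elts y. \<kappa> v = \<kappa> w \<longrightarrow> v \<in> elts C" if "C \<in> elts \<C>" for C using that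
    proof (rule induct)
      show "\<forall>w\<in>elts C0. \<forall>v\<in>elts y. \<kappa> v = \<kappa> w \<longrightarrow> v \<in> elts C0" unfolding C0_def elts_class_of_y by auto
      show "\<forall>w\<in>elts (out C). \<forall>v\<in>elts y. \<kappa> v = \<kappa> w \<longrightarrow> v \<in> elts (out C)" if "C \<in> elts \<C>" for C
        using sub[OF that] sat unfolding out by blast
    qed (intro dfns)
    have C0_sub: "elts C0 \<subseteq> elts C" if "C \<in> elts \<C>" for C using that
    proof (rule induct)
      show "elts C0 \<subseteq> elts (out C)" if "C \<in> elts \<C>" "elts C0 \<subseteq> elts C" for C
        using that infl[of C] by blast
    qed (intro dfns, rule subset_refl)
    \<comment> \<open>Orbits of a monotone inflationary map are chains: no member lies strictly
      between \<open>C\<close> and \<open>out C\<close> or is incomparable with both. The proof is a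
      double induction along the orbit.\<close>
    have step: "\<forall>D\<in>elts \<C>. elts D \<subseteq> elts C \<or> elts (out C) \<subseteq> elts D" if "C \<in> elts \<C>" for C using that
    proof (rule induct)
      show "definable (\<lambda>e. \<forall>D\<in>elts \<C>. elts D \<subseteq> elts (e 0) \<or> elts (out (e 0)) \<subseteq> elts D)"
        by (intro dfns term_app1[OF definable_fun_out])
      show "\<forall>D\<in>elts \<C>. elts D \<subseteq> elts C0 \<or> elts (out C0) \<subseteq> elts D"
      proof
        fix D assume "D \<in> elts \<C>"
        then show "elts D \<subseteq> elts C0 \<or> elts (out C0) \<subseteq> elts D"
        proof (rule induct)
          show "definable (\<lambda>e. elts (e 0) \<subseteq> elts C0 \<or> elts (out C0) \<subseteq> elts (e 0))" by (intro dfns)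
          show "elts (out D) \<subseteq> elts C0 \<or> elts (out C0) \<subseteq> elts (out D)" if "D \<in> elts \<C>" for D
            using out_mono[OF C0_sub[OF that]] by blast
        qed blast
      qed
      fix C assume C: "C \<in> elts \<C>" and IH: "\<forall>D\<in>elts \<C>. elts D \<subseteq> elts C \<or> elts (out C) \<subseteq> elts D"
      show "\<forall>D\<in>elts \<C>. elts D \<subseteq> elts (out C) \<or> elts (out (out C)) \<subseteq> elts D"
      proof
        fix D assume "D \<in> elts \<C>"
        then show "elts D \<subseteq> elts (out C) \<or> elts (out (out C)) \<subseteq> elts D"
        proof (rule induct)
          show "definable (\<lambda>e. elts (e 0) \<subseteq> elts (out C) \<or> elts (out (out C)) \<subseteq> elts (e 0))" by (intro dfns)
          show "elts C0 \<subseteq> elts (out C) \<or> elts (out (out C)) \<subseteq> elts C0"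
            using C0_sub[OF out_in[OF C]] by blast
          fix D assume D: "D \<in> elts \<C>" and IH': "elts D \<subseteq> elts (out C) \<or> elts (out (out C)) \<subseteq> elts D"
          consider "elts D \<subseteq> elts C" | "elts (out C) \<subseteq> elts D" using IH D by blast
          then show "elts (out D) \<subseteq> elts (out C) \<or> elts (out (out C)) \<subseteq> elts (out D)"
            using out_mono by cases blast+
        qed
      qed
    qed
    have "internally_finite (\<Union>C\<in>elts \<C>. elts C)"
    proof (rule no_infinite_chain[OF k])
      show "elts C \<subseteq> elts D \<or> elts D \<subseteq> elts C" if "C \<in> elts \<C>" "D \<in> elts \<C>" for C D
        using step[OF that(1)] infl[OF that(1)] that(2) by blast
    qed (use finC sub satC in blast)+
    moreover obtain U where U: "elts U = (\<Union>C\<in>elts \<C>. elts C)"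
      using small_Union[OF small_elts] unfolding small_def by blast
    \<comment> \<open>The union of all stages is closed under \<open>R\<close>, so it contains the
      infinite set reachable from \<open>w0\<close>, although the chain lemma makes it
      finite.\<close>
    moreover have "elts (reach w0) \<subseteq> elts U"
    proof (rule reach_least)
      show "elts U \<subseteq> elts y" using U sub by auto
      have "w0 \<in> elts C0" unfolding C0_def elts_class_of_y using w0 by simp
      then show "w0 \<in> elts U" using U C0 by auto
      show "v \<in> elts U" if uv: "u \<in> elts U" "v \<in> elts y" "R u v" for u v
      proof -
        obtain C where C: "C \<in> elts \<C>" "u \<in> elts C" using uv(1) unfolding U by blast
        then have "v \<in> elts (out C)" unfolding out using uv by blast
        then show ?thesis unfolding U using out_in[OF C(1)] by blast
      qed
    qed
    ultimately show False using inf is_finite_subset[of U "reach w0"] internally_finite_elts by metis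
  qed
qed

end

section \<open>Excluded class structures\<close>

lemma subset_sum_six:
  fixes c :: "'b \<Rightarrow> nat"
  assumes "finite S" "d = 2 \<or> d = 3" "\<And>x. x \<in> S \<Longrightarrow> c x = 1 \<or> c x = d" "7 \<le> sum c S"
  shows "\<exists>T\<subseteq>S. sum c T = 6"
proof -
  define A where "A = {x \<in> S. c x = 1}"
  define B where "B = {x \<in> S. c x = d}"
  have AB: "S = A \<union> B" "A \<inter> B = {}" "finite A" "finite B"
    using assms unfolding A_def B_def by auto
  have "sum c A = card A" "sum c B = d * card B" unfolding A_def B_def by simp_all
  then have "7 \<le> card A + d * card B"
    using assms(4) AB by (simp add: sum.union_disjoint)
  \<comment> \<open>Three twos or two threes give six. With exactly two twos there are at least
    three ones, and 2+2+1+1 works; with at most one \<open>d\<close>, ones fill up the rest.\<close>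
  then have "\<exists>a b. a \<le> card A \<and> b \<le> card B \<and> a + d * b = 6"
  proof (cases "card B \<ge> 2")
    case True
    from assms(2) show ?thesis
    proof
      assume d: "d = 2"
      show ?thesis
      proof (cases "card B \<ge> 3")
        case True
        then show ?thesis using d by (intro exI[of _ 0] exI[of _ 3]) simp
      next
        case False
        then show ?thesis using d True \<open>7 \<le> card A + d * card B\<close>
          by (intro exI[of _ 2] exI[of _ 2]) simp
      qed
    next
      assume "d = 3"
      then show ?thesis using True by (intro exI[of _ 0] exI[of _ 2]) simp
    qed
  next
    case False
    then have "card B = 0 \<or> card B = 1" by auto
    then show ?thesis using assms(2) \<open>7 \<le> card A + d * card B\<close>
      by (intro exI[of _ "6 - d * card B"] exI[of _ "card B"]) auto
  qed
  then obtain a b where ab: "a \<le> card A" "b \<le> card B" "a + d * b = 6" by blast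
  obtain A' where A': "A' \<subseteq> A" "card A' = a" "finite A'" using obtain_subset_with_card_n[OF ab(1)] .
  obtain B' where B': "B' \<subseteq> B" "card B' = b" "finite B'" using obtain_subset_with_card_n[OF ab(2)] .
  have "sum c A' = a" using A' unfolding A_def by (simp add: subset_iff sum.cong[where h="\<lambda>_. 1"])
  moreover have "sum c B' = d * b" using B' unfolding B_def by (simp add: subset_iff sum.cong[where h="\<lambda>_. d"])
  moreover have "A' \<inter> B' = {}" using A' B' AB by auto
  ultimately have "sum c (A' \<union> B') = 6" using A' B' ab by (simp add: sum.union_disjoint)
  then show ?thesis using A' B' AB by (intro exI[of _ "A' \<union> B'"]) auto
qed

lemma card_image_times_fiber:
  assumes "finite W" "\<And>v. v \<in> W \<Longrightarrow> card {u \<in> W. f u = f v} = c"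
  shows "card W = card (f ` W) * c"
proof -
  have "card W = (\<Sum>b\<in>f ` W. card {u \<in> W. f u = b})"
    using sum.image_gen[OF assms(1), of "\<lambda>_. 1::nat" f] by simp
  also have "\<dots> = (\<Sum>b\<in>f ` W. c)" using assms(2) by (intro sum.cong) auto
  finally show ?thesis by simp
qed

text \<open>Constant fibre sizes make every image size a divisor of \<open>card W\<close>, and the
  seven distinct values at \<open>w\<close> force the disjoint blocks to have at least seven points
  in total. If no block has six points and the sizes 3 and 2 both occur, then \<open>card W\<close>
  is six and the fibre sizes are 2 and 3; otherwise a subsum gives six.\<close>

lemma six_from_blocks:
  fixes \<rho> :: "nat \<Rightarrow> 'b \<Rightarrow> 'c"
  assumes W: "finite W" "card W \<in> {1, 2, 3, 6}" "w \<in> W" "inj_on (\<lambda>i. \<rho> i w) {..<7}"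
    and fib: "\<And>i u v. i < 7 \<Longrightarrow> u \<in> W \<Longrightarrow> v \<in> W \<Longrightarrow>
      card {x \<in> W. \<rho> i x = \<rho> i u} = card {x \<in> W. \<rho> i x = \<rho> i v}"
    and blk: "\<And>i j. i < 7 \<Longrightarrow> j < 7 \<Longrightarrow> \<rho> i ` W \<subseteq> \<rho> j ` W \<or> \<rho> i ` W \<inter> \<rho> j ` W = {}"
  shows "(\<exists>J\<subseteq>{..<7}. card (\<Union>i\<in>J. \<rho> i ` W) = 6) \<or>
    (card W = 6 \<and> (\<exists>i<7. \<exists>j<7. (\<forall>v\<in>W. card {x \<in> W. \<rho> i x = \<rho> i v} = 2) \<and>
      (\<forall>v\<in>W. card {x \<in> W. \<rho> j x = \<rho> j v} = 3)))"
proof -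
  define c where "c i = card {x \<in> W. \<rho> i x = \<rho> i w}" for i
  have c: "card {x \<in> W. \<rho> i x = \<rho> i v} = c i" if "i < 7" "v \<in> W" for i v
    unfolding c_def using fib that W(3) by blast
  have prod: "card W = card (\<rho> i ` W) * c i" if "i < 7" for i
    using card_image_times_fiber[OF W(1)] c[OF that] by blast
  have div: "card (\<rho> i ` W) \<in> {1, 2, 3, 6}" if "i < 7" for i
  proof -
    have dvd: "card (\<rho> i ` W) dvd card W" using prod[OF that] by simp
    then have "card (\<rho> i ` W) \<le> 6" using W(2) by (auto dest: dvd_imp_le)
    then consider "card (\<rho> i ` W) = 0" | "card (\<rho> i ` W) = 1" | "card (\<rho> i ` W) = 2" |
      "card (\<rho> i ` W) = 3" | "card (\<rho> i ` W) = 4" | "card (\<rho> i ` W) = 5" | "card (\<rho> i ` W) = 6"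
      by linarith
    then show ?thesis using dvd W(2) by cases auto
  qed
  \<comment> \<open>A set of images, not an indexed family: coordinates with the same image
    contribute only one block to the sum.\<close>
  define \<S> where "\<S> = (\<lambda>i. \<rho> i ` W) ` {..<7}"
  have fin\<S>: "finite \<S>" unfolding \<S>_def by simp
  have disj: "pairwise disjnt \<S>"
    unfolding \<S>_def pairwise_def disjnt_def
  proof (intro ballI impI)
    fix A B assume "A \<in> (\<lambda>i. \<rho> i ` W) ` {..<7}" "B \<in> (\<lambda>i. \<rho> i ` W) ` {..<7}" "A \<noteq> B"
    then obtain i j where "i < 7" "j < 7" "A = \<rho> i ` W" "B = \<rho> j ` W" by auto
    then show "A \<inter> B = {}" using blk[of i j] blk[of j i] \<open>A \<noteq> B\<close> by blast
  qed
  have fin: "finite A" if "A \<in> \<S>" for A using that W(1) unfolding \<S>_def by auto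
  have card_Un: "card (\<Union>\<T>) = sum card \<T>" if "\<T> \<subseteq> \<S>" for \<T>
    using that fin disj by (intro card_Union_disjoint) (auto intro: pairwise_subset)
  have seven: "7 \<le> sum card \<S>"
  proof -
    have "(\<lambda>i. \<rho> i w) ` {..<7} \<subseteq> \<Union>\<S>" using W(3) unfolding \<S>_def by auto
    moreover have "finite (\<Union>\<S>)" using fin fin\<S> by auto
    ultimately have "card ((\<lambda>i. \<rho> i w) ` {..<7}) \<le> card (\<Union>\<S>)" by (intro card_mono)
    then show ?thesis using card_image[OF W(4)] card_Un[of \<S>] by simp
  qed
  have J: "\<exists>J\<subseteq>{..<7}. card (\<Union>i\<in>J. \<rho> i ` W) = 6" if "\<T> \<subseteq> \<S>" "sum card \<T> = 6" for \<T>
  proof (intro exI conjI)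
    have "(\<lambda>i. \<rho> i ` W) ` {i. i < 7 \<and> \<rho> i ` W \<in> \<T>} = \<T>" using that(1) unfolding \<S>_def by auto
    then show "card (\<Union>i\<in>{i. i < 7 \<and> \<rho> i ` W \<in> \<T>}. \<rho> i ` W) = 6" using card_Un[OF that(1)] that(2) by simp
  qed auto
  show ?thesis
  proof (cases "\<exists>i<7. card (\<rho> i ` W) = 6")
    case True
    then obtain i where "i < 7" "card (\<rho> i ` W) = 6" by blast
    then have "{\<rho> i ` W} \<subseteq> \<S>" "sum card {\<rho> i ` W} = 6" unfolding \<S>_def by auto
    then show ?thesis using J by blast
  next
    case no6: False
    show ?thesis
    proof (cases "(\<exists>i<7. card (\<rho> i ` W) = 3) \<and> (\<exists>j<7. card (\<rho> j ` W) = 2)")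
      case True
      then obtain i j where ij: "i < 7" "card (\<rho> i ` W) = 3" "j < 7" "card (\<rho> j ` W) = 2" by blast
      then have "card W = 3 * c i" "card W = 2 * c j" using prod[of i] prod[of j] by simp_all
      then have "card W = 6" "c i = 2" "c j = 3" using W(2) by (auto; presburger)+
      then show ?thesis using ij c by (intro disjI2 conjI exI[of _ i] exI[of _ j]) auto
    next
      case False
      have in123: "card A = 1 \<or> card A = 2 \<or> card A = 3" if "A \<in> \<S>" for A
        using that div no6 unfolding \<S>_def by fastforce
      have "\<exists>d. (d = 2 \<or> d = 3) \<and> (\<forall>A\<in>\<S>. card A = 1 \<or> card A = d)"
      proof (cases "\<exists>i<7. card (\<rho> i ` W) = 3")
        case True
        then have "\<forall>A\<in>\<S>. card A \<noteq> 2" using False unfolding \<S>_def by auto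
        then show ?thesis using in123 by blast
      next
        case False
        then have "\<forall>A\<in>\<S>. card A \<noteq> 3" unfolding \<S>_def by auto
        then show ?thesis using in123 by blast
      qed
      then obtain d where "d = 2 \<or> d = 3" "\<And>A. A \<in> \<S> \<Longrightarrow> card A = 1 \<or> card A = d" by blast
      then obtain \<T> where "\<T> \<subseteq> \<S>" "sum card \<T> = 6" using subset_sum_six[OF fin\<S> _ _ seven] by blast
      then show ?thesis using J by blast
    qed
  qed
qed

context homogeneous
begin

section \<open>Excluding sizes by definable splittings\<close>

lemma split_internally_finite:
  assumes "definable (\<lambda>e. P (e 0))"
  shows "internally_finite {w. w \<in> elts y \<and> (\<exists>v\<in>elts y. \<kappa> v = \<kappa> w \<and> P v) \<and> (\<exists>v\<in>elts y. \<kappa> v = \<kappa> w \<and> \<not> P v)}"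
    (is "internally_finite ?S")
proof -
  have "small ?S" by (rule small_sep) (intro definable_intros term_kappa definable_app1[OF assms])
  then obtain S where S: "?S = elts S" by (rule smallE)
  have "is_finite S" by (rule split_finite[OF assms]) (use S in blast)+
  then show ?thesis unfolding S by simp
qed

lemma internally_finite_cls: "w \<in> elts y \<Longrightarrow> internally_finite {v. v \<in> elts y \<and> \<kappa> v = \<kappa> w}"
  using is_finite_class_of[of w] internally_finite_elts[of "class_of \<kappa> y w"] unfolding elts_class_of_y by simp

lemma card_class: "w \<in> elts y \<Longrightarrow> finite {v. v \<in> elts y \<and> \<kappa> v = \<kappa> w} \<and> card {v. v \<in> elts y \<and> \<kappa> v = \<kappa> w} = k"
  using card_class_of[of w] unfolding elts_class_of_y has_card_def .

lemma phi_select: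
  assumes "elts z \<subseteq> elts y" "finite (elts z)" "6 < card (elts z)"
  shows "elts (\<phi> z) \<subseteq> elts z" "card (elts (\<phi> z)) = 6" "finite (elts (\<phi> z))"
proof -
  have "is_finite z" using internally_finite_finite[OF assms(2)] by simp
  then show "elts (\<phi> z) \<subseteq> elts z" "card (elts (\<phi> z)) = 6" "finite (elts (\<phi> z))"
    using select_y assms unfolding selects_def exceeds_def has_card_def by blast+
qed

text \<open>
  A six-element subset of the union of two classes splits one of them, which orients the pair.
\<close>

lemma class_size_not_4_5: assumes "k = 4 \<or> k = 5" shows False
proof -
  define Z where "Z w v = the_elt_of {u. u \<in> elts y \<and> (\<kappa> u = \<kappa> w \<or> \<kappa> u = \<kappa> v)}" for w v
  have Z: "elts (Z w v) = {u. u \<in> elts y \<and> (\<kappa> u = \<kappa> w \<or> \<kappa> u = \<kappa> v)}" for w v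
    unfolding Z_def by (rule elts_sep) (intro definable_intros term_kappa)
  have Z_cong: "Z w v' = Z w v" if "\<kappa> v' = \<kappa> v" for w v v' unfolding Z_def that ..
  have Z_sym: "Z w v = Z v w" for w v by (auto simp: Z simp flip: elts_inject)
  have term_Z: "definable_term (\<lambda>e. Z (t e) (s e))" if "definable_term t" "definable_term s" for t s
    by (rule term_lift2[OF _ that]) (unfold Z_def, intro definable_intros term_kappa)
  note dfns = definable_intros term_kappa term_phi term_Z
  \<comment> \<open>The class split is the one of the second argument, so for fixed \<open>w\<close>
    homogeneity bounds the number of classes that \<open>w\<close> points to.\<close>
  define R where "R w v \<longleftrightarrow> \<kappa> v = \<kappa> w \<or> (\<exists>a\<in>elts y. \<kappa> a = \<kappa> v \<and> a \<in> elts (\<phi> (Z w v))) \<and>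
     (\<exists>a\<in>elts y. \<kappa> a = \<kappa> v \<and> a \<notin> elts (\<phi> (Z w v)))" for w v
  show False
  proof (rule no_locally_finite_tournament[of R])
    show "1 < k" using assms by auto
    show "definable (\<lambda>e. R (e 0) (e 1))" unfolding R_def by (intro dfns)
    show "R w v" if "\<kappa> v = \<kappa> w" for w v unfolding R_def using that by simp
    show "R w v'" if "R w v" "\<kappa> v' = \<kappa> v" for w v v'
      using that Z_cong[OF that(2), of w] unfolding R_def by simp
    fix w assume w: "w \<in> elts y"
    show "R w v \<or> R v w" if v: "v \<in> elts y" for v
    proof (rule ccontr)
      let ?W = "{u. u \<in> elts y \<and> \<kappa> u = \<kappa> w}" and ?V = "{u. u \<in> elts y \<and> \<kappa> u = \<kappa> v}"
      assume *: "\<not> (R w v \<or> R v w)"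
      then have ne: "\<kappa> v \<noteq> \<kappa> w" unfolding R_def by auto
      have ZWV: "elts (Z w v) = ?W \<union> ?V" unfolding Z by auto
      have disj: "?W \<inter> ?V = {}" using ne by auto
      note W = card_class[OF w] and V = card_class[OF v]
      have card2: "card (?W \<union> ?V) = k + k" using card_Un_disjoint[OF _ _ disj] W V by simp
      have sub: "elts (Z w v) \<subseteq> elts y" unfolding Z by blast
      have "finite (elts (Z w v))" unfolding ZWV using W V by blast
      moreover have "6 < card (elts (Z w v))" unfolding ZWV card2 using assms by auto
      ultimately have \<phi>: "elts (\<phi> (Z w v)) \<subseteq> ?W \<union> ?V" "card (elts (\<phi> (Z w v))) = 6"
        using phi_select[OF sub] unfolding ZWV by blast+
      have "?V \<subseteq> elts (\<phi> (Z w v)) \<or> ?V \<inter> elts (\<phi> (Z w v)) = {}"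
        using * unfolding R_def by blast
      moreover have "?W \<subseteq> elts (\<phi> (Z w v)) \<or> ?W \<inter> elts (\<phi> (Z w v)) = {}"
        using * unfolding R_def Z_sym[of v w] by blast
      \<comment> \<open>An unsplit selection is a union of some of the two classes, so its size is
        0, \<open>k\<close> or 2\<open>k\<close>, which differs from six for \<open>k\<close> = 4
        and \<open>k\<close> = 5.\<close>
      ultimately have "elts (\<phi> (Z w v)) = {} \<or> elts (\<phi> (Z w v)) = ?W \<or>
          elts (\<phi> (Z w v)) = ?V \<or> elts (\<phi> (Z w v)) = ?W \<union> ?V"
        using \<phi>(1) by blast
      then have "card (elts (\<phi> (Z w v))) = 0 \<or> card (elts (\<phi> (Z w v))) = k \<or> card (elts (\<phi> (Z w v))) = k + k"
        by (elim disjE) (simp_all only: W V card2 card.empty simp_thms)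
      then show False using \<phi>(2) assms by auto
    qed
    \<comment> \<open>The second argument of \<open>Z\<close> is the tested point \<open>a\<close>
      instead of \<open>v\<close>. Both give the same set by \<open>Z_cong\<close>, and the
      condition becomes a predicate of \<open>a\<close> alone.\<close>
    let ?S = "{v. v \<in> elts y \<and> (\<exists>a\<in>elts y. \<kappa> a = \<kappa> v \<and> a \<in> elts (\<phi> (Z w a))) \<and>
       (\<exists>a\<in>elts y. \<kappa> a = \<kappa> v \<and> \<not> a \<in> elts (\<phi> (Z w a)))}"
    have "internally_finite ?S" by (rule split_internally_finite) (intro dfns)
    then have "internally_finite ({v. v \<in> elts y \<and> \<kappa> v = \<kappa> w} \<union> ?S)" by (intro internally_finite_Un internally_finite_cls w)
    moreover have "{v. v \<in> elts y \<and> R w v} \<subseteq> {v. v \<in> elts y \<and> \<kappa> v = \<kappa> w} \<union> ?S"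
    proof
      fix v assume v: "v \<in> {v. v \<in> elts y \<and> R w v}"
      show "v \<in> {v. v \<in> elts y \<and> \<kappa> v = \<kappa> w} \<union> ?S"
      proof (cases "\<kappa> v = \<kappa> w")
        case False
        then obtain a b where "a \<in> elts y" "\<kappa> a = \<kappa> v" "a \<in> elts (\<phi> (Z w v))"
          "b \<in> elts y" "\<kappa> b = \<kappa> v" "b \<notin> elts (\<phi> (Z w v))"
          using v unfolding R_def by blast
        then have "v \<in> ?S" using v Z_cong[of a v w] Z_cong[of b v w] by auto
        then show ?thesis by blast
      qed (use v in blast)
    qed
    moreover have "small {v. v \<in> elts y \<and> R w v}" unfolding R_def by (rule small_sep) (intro dfns)
    ultimately show "internally_finite {v. v \<in> elts y \<and> R w v}" by (rule internally_finite_subset)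
  qed
qed


text \<open>
  The union of a \<open>g\<close>-fibre of one class and the complement of an \<open>f\<close>-fibre of another has seven
  elements. The element omitted by the selection splits one of the classes, unless it always lies
  in the class of the \<open>g\<close>-fibre and always in the class of the \<open>f\<close>-fibre.
\<close>

lemma no_fibers_2_3:
  assumes k: "k = 6" and f: "definable_fun f" and g: "definable_fun g"
    and f2: "\<And>w. w \<in> elts y \<Longrightarrow> card {v. v \<in> elts y \<and> \<kappa> v = \<kappa> w \<and> f v = f w} = 2"
    and g3: "\<And>w. w \<in> elts y \<Longrightarrow> card {v. v \<in> elts y \<and> \<kappa> v = \<kappa> w \<and> g v = g w} = 3"
  shows False
proof -
  define Z where "Z q p = the_elt_of {u. u \<in> elts y \<and> (\<kappa> u = \<kappa> q \<and> g u = g q \<or> \<kappa> u = \<kappa> p \<and> f u \<noteq> f p)}" for q p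
  have Z: "elts (Z q p) = {u. u \<in> elts y \<and> (\<kappa> u = \<kappa> q \<and> g u = g q \<or> \<kappa> u = \<kappa> p \<and> f u \<noteq> f p)}" for q p
    unfolding Z_def by (rule elts_sep) (intro definable_intros term_kappa term_app1[OF f] term_app1[OF g])
  have term_Z: "definable_term (\<lambda>e. Z (t e) (s e))" if "definable_term t" "definable_term s" for t s
    by (rule term_lift2[OF _ that]) (unfold Z_def, intro definable_intros term_kappa term_app1[OF f] term_app1[OF g])
  define omit where "omit q p u \<longleftrightarrow> u \<in> elts (Z q p) \<and> u \<notin> elts (\<phi> (Z q p))" for q p u
  have definable_omit: "definable (\<lambda>e. omit (t e) (s e) (r e))" if "definable_term t" "definable_term s" "definable_term r" for t s r
    unfolding omit_def by (intro definable_intros term_phi term_Z that)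
  note dfns = definable_intros term_kappa definable_omit
  have omit1: "\<exists>!u. omit q p u" if q: "q \<in> elts y" and p: "p \<in> elts y" and ne: "\<kappa> q \<noteq> \<kappa> p" for q p
  proof -
    let ?A = "{u. u \<in> elts y \<and> \<kappa> u = \<kappa> q \<and> g u = g q}"
    let ?P = "{u. u \<in> elts y \<and> \<kappa> u = \<kappa> p}"
    let ?F = "{u. u \<in> elts y \<and> \<kappa> u = \<kappa> p \<and> f u = f p}"
    have P: "finite ?P" "card ?P = 6" using card_class[OF p] k by auto
    have "finite ?A" using card_class[OF q] by (rule_tac finite_subset[of _ "{u. u \<in> elts y \<and> \<kappa> u = \<kappa> q}"]) auto
    have "finite ?F" using P(1) by (rule_tac finite_subset[of _ ?P]) auto
    then have "card (?P - ?F) = 4" using P f2[OF p] by (subst card_Diff_subset) auto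
    then have "card (?A \<union> (?P - ?F)) = 7"
      using g3[OF q] \<open>finite ?A\<close> P(1) ne by (subst card_Un_disjoint) auto
    moreover have "elts (Z q p) = ?A \<union> (?P - ?F)" unfolding Z by blast
    ultimately have seven: "card (elts (Z q p)) = 7" "finite (elts (Z q p))"
      using \<open>finite ?A\<close> P(1) by simp_all
    have "elts (Z q p) \<subseteq> elts y" unfolding Z by blast
    from phi_select[OF this seven(2)] seven(1)
    have "elts (\<phi> (Z q p)) \<subseteq> elts (Z q p)" "card (elts (\<phi> (Z q p))) = 6" "finite (elts (\<phi> (Z q p)))" by simp_all
    then have "card (elts (Z q p) - elts (\<phi> (Z q p))) = 1" using seven by (simp add: card_Diff_subset)
    then obtain u where "elts (Z q p) - elts (\<phi> (Z q p)) = {u}" by (rule card_1_singletonE)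
    then have "omit q p v \<longleftrightarrow> v = u" for v unfolding omit_def by auto
    then show ?thesis by simp
  qed
  have omit_side: "u \<in> elts y \<and> (\<kappa> u = \<kappa> q \<or> \<kappa> u = \<kappa> p)" if "omit q p u" for q p u
    using that unfolding omit_def Z by blast
  define at_q where "at_q q p \<longleftrightarrow> (\<exists>u. omit q p u \<and> \<kappa> u = \<kappa> q)" for q p
  define at_p where "at_p q p \<longleftrightarrow> (\<exists>u. omit q p u \<and> \<kappa> u = \<kappa> p)" for q p
  have definable_at_q: "definable (\<lambda>e. at_q (t e) (s e))" if "definable_term t" "definable_term s" for t s
    by (rule definable_lift2[OF _ that]) (unfold at_q_def, intro dfns)
  have definable_at_p: "definable (\<lambda>e. at_p (t e) (s e))" if "definable_term t" "definable_term s" for t s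
    by (rule definable_lift2[OF _ that]) (unfold at_p_def, intro dfns)
  \<comment> \<open>In the first alternative \<open>w\<close> provides the \<open>g\<close>-fibre,
    in the second it fixes the complement of the \<open>f\<close>-fibre; either way some omission
    falls outside the class of \<open>w\<close>.\<close>
  define R where "R w v \<longleftrightarrow> \<kappa> v = \<kappa> w \<or> (\<exists>a\<in>elts y. \<kappa> a = \<kappa> v \<and> \<not> at_q w a) \<or>
      (\<exists>a\<in>elts y. \<kappa> a = \<kappa> v \<and> \<not> at_p a w)" for w v
  \<comment> \<open>The omitted elements cannot fill a class, since they only depend on a fibre.\<close>
  have not_all: "\<exists>a\<in>elts y. \<kappa> a = \<kappa> v \<and> \<not> (\<exists>b\<in>elts y. \<kappa> b = \<kappa> a \<and> Q b a)"
    if v: "v \<in> elts y" and h: "card {u. u \<in> elts y \<and> \<kappa> u = \<kappa> v \<and> h u = h v} \<ge> 2"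
      and Q: "\<And>a a' b b'. Q b a \<Longrightarrow> Q b' a' \<Longrightarrow> b \<in> elts y \<Longrightarrow> b' \<in> elts y \<Longrightarrow>
        \<kappa> b = \<kappa> v \<Longrightarrow> \<kappa> b' = \<kappa> v \<Longrightarrow> h b = h b' \<Longrightarrow> a = a'"
    for v and h :: "'a \<Rightarrow> 'a" and Q
  proof (rule ccontr)
    let ?V = "{u. u \<in> elts y \<and> \<kappa> u = \<kappa> v}"
    assume "\<not> ?thesis"
    then have ex: "\<exists>b. b \<in> elts y \<and> \<kappa> b = \<kappa> v \<and> Q b a" if "a \<in> ?V" for a using that by auto
    define b where "b a = (SOME b. b \<in> elts y \<and> \<kappa> b = \<kappa> v \<and> Q b a)" for a
    have b: "b a \<in> elts y \<and> \<kappa> (b a) = \<kappa> v \<and> Q (b a) a" if "a \<in> ?V" for a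
      unfolding b_def by (rule someI_ex[OF ex[OF that]])
    \<comment> \<open>Were all points of the class omitted ones, \<open>h\<close> would have as many
      values on the class as it has points, contrary to a fibre with two elements.\<close>
    have "inj_on (\<lambda>a. h (b a)) ?V"
    proof (rule inj_onI)
      fix a a' assume aa': "a \<in> ?V" "a' \<in> ?V" "h (b a) = h (b a')"
      show "a = a'" using Q[of "b a" a "b a'" a'] b[OF aa'(1)] b[OF aa'(2)] aa'(3) by blast
    qed
    moreover have "(\<lambda>a. h (b a)) ` ?V \<subseteq> h ` ?V" using b by auto
    moreover have fin: "finite ?V" using card_class[OF v] by blast
    ultimately have "card ?V \<le> card (h ` ?V)"
      by (intro card_inj_on_le[of "\<lambda>a. h (b a)"] finite_imageI)
    then have "inj_on h ?V" using fin by (intro eq_card_imp_inj_on) (auto intro: antisym card_image_le)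
    then have "{u. u \<in> elts y \<and> \<kappa> u = \<kappa> v \<and> h u = h v} \<subseteq> {v}" using v unfolding inj_on_def by blast
    then have "card {u. u \<in> elts y \<and> \<kappa> u = \<kappa> v \<and> h u = h v} \<le> card {v}" by (intro card_mono) auto
    then show False using h by simp
  qed
  show False
  proof (rule no_locally_finite_tournament[of R])
    show "1 < k" using k by simp
    show "definable (\<lambda>e. R (e 0) (e 1))" unfolding R_def by (intro dfns definable_at_q definable_at_p)
    show "R w v" if "\<kappa> v = \<kappa> w" for w v unfolding R_def using that by simp
    show "R w v'" if "R w v" "\<kappa> v' = \<kappa> v" for w v v' using that unfolding R_def by simp
    fix w assume w: "w \<in> elts y"
    show "R w v \<or> R v w" if v: "v \<in> elts y" for v
    proof (rule ccontr)
      assume "\<not> (R w v \<or> R v w)"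
      \<comment> \<open>Failure of \<open>R w v\<close> gives \<open>at_q w v\<close>, failure of
        \<open>R v w\<close> gives \<open>at_p w v\<close>; the single omitted point would lie in
        two different classes.\<close>
      then have ne: "\<kappa> w \<noteq> \<kappa> v" and "at_q w v" "at_p w v" using w v unfolding R_def by auto
      then show False using omit1[OF w v ne] unfolding at_q_def at_p_def by metis
    qed
    let ?split = "\<lambda>P. {v. v \<in> elts y \<and> (\<exists>a\<in>elts y. \<kappa> a = \<kappa> v \<and> P a) \<and> (\<exists>a\<in>elts y. \<kappa> a = \<kappa> v \<and> \<not> P a)}"
    \<comment> \<open>If \<open>at_q w\<close> fails on the whole class of \<open>v\<close>, the
      omitted points all lie in that class. \<open>?P1\<close> marks them; there is at least one and
      at most one per \<open>f\<close>-fibre, so the class is split. \<open>?P2\<close> does the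
      same with \<open>g\<close>-fibres.\<close>
    let ?P1 = "\<lambda>a. \<exists>b\<in>elts y. \<kappa> b = \<kappa> a \<and> omit w b a"
    let ?P2 = "\<lambda>a. \<exists>b\<in>elts y. \<kappa> b = \<kappa> a \<and> omit b w a"
    have "internally_finite (?split (at_q w))" by (rule split_internally_finite) (intro dfns definable_at_q definable_at_p)
    moreover have "internally_finite (?split (\<lambda>a. at_p a w))" by (rule split_internally_finite) (intro dfns definable_at_q definable_at_p)
    moreover have "internally_finite (?split ?P1)" by (rule split_internally_finite) (intro dfns)
    moreover have "internally_finite (?split ?P2)" by (rule split_internally_finite) (intro dfns)
    ultimately have "internally_finite ({v. v \<in> elts y \<and> \<kappa> v = \<kappa> w} \<union>
        (?split (at_q w) \<union> (?split (\<lambda>a. at_p a w) \<union> (?split ?P1 \<union> ?split ?P2))))"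
      by (intro internally_finite_Un internally_finite_cls w)
    moreover have "{v. v \<in> elts y \<and> R w v} \<subseteq> {v. v \<in> elts y \<and> \<kappa> v = \<kappa> w} \<union>
        (?split (at_q w) \<union> (?split (\<lambda>a. at_p a w) \<union> (?split ?P1 \<union> ?split ?P2)))"
    proof
      fix v assume "v \<in> {v. v \<in> elts y \<and> R w v}"
      then have v: "v \<in> elts y" and Rwv: "R w v" by auto
      have split1: "v \<in> ?split ?P1" if no: "\<forall>a\<in>elts y. \<kappa> a = \<kappa> v \<longrightarrow> \<not> at_q w a" and ne: "\<kappa> w \<noteq> \<kappa> v"
      proof -
        obtain u where u: "omit w v u" using omit1[OF w v ne] by blast
        then have "u \<in> elts y" "\<kappa> u = \<kappa> v" using omit_side[OF u] no v unfolding at_q_def by blast+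
        then have "\<exists>a\<in>elts y. \<kappa> a = \<kappa> v \<and> ?P1 a"
          using u v by (intro bexI[of _ u] conjI bexI[of _ v]) simp_all
        moreover have "\<exists>a\<in>elts y. \<kappa> a = \<kappa> v \<and> \<not> ?P1 a"
        proof (rule not_all[where h=f])
          fix a a' b b' assume *: "omit w b a" "omit w b' a'" "b \<in> elts y" "b' \<in> elts y"
            "\<kappa> b = \<kappa> v" "\<kappa> b' = \<kappa> v" "f b = f b'"
          \<comment> \<open>The set depends on its second argument only through the class and the
            \<open>f\<close>-fibre.\<close>
          then have "Z w b = Z w b'" unfolding Z_def by simp
          then have "omit w b a'" using *(2) unfolding omit_def by simp
          then show "a = a'" using omit1[OF w *(3)] *(1,5) ne by auto
        qed (use v f2[OF v] in auto)
        ultimately show ?thesis using v by blast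
      qed
      have split2: "v \<in> ?split ?P2" if no: "\<forall>a\<in>elts y. \<kappa> a = \<kappa> v \<longrightarrow> \<not> at_p a w" and ne: "\<kappa> v \<noteq> \<kappa> w"
      proof -
        obtain u where u: "omit v w u" using omit1[OF v w ne] by blast
        then have "u \<in> elts y" "\<kappa> u = \<kappa> v" using omit_side[OF u] no v unfolding at_p_def by blast+
        then have "\<exists>a\<in>elts y. \<kappa> a = \<kappa> v \<and> ?P2 a"
          using u v by (intro bexI[of _ u] conjI bexI[of _ v]) simp_all
        moreover have "\<exists>a\<in>elts y. \<kappa> a = \<kappa> v \<and> \<not> ?P2 a"
        proof (rule not_all[where h=g])
          fix a a' b b' assume *: "omit b w a" "omit b' w a'" "b \<in> elts y" "b' \<in> elts y"
            "\<kappa> b = \<kappa> v" "\<kappa> b' = \<kappa> v" "g b = g b'"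
          then have "Z b w = Z b' w" unfolding Z_def by simp
          then have "omit b w a'" using *(2) unfolding omit_def by simp
          then show "a = a'" using omit1[OF *(3) w] *(1,5) ne by auto
        qed (use v g3[OF v] in auto)
        ultimately show ?thesis using v by blast
      qed
      show "v \<in> {v. v \<in> elts y \<and> \<kappa> v = \<kappa> w} \<union>
        (?split (at_q w) \<union> (?split (\<lambda>a. at_p a w) \<union> (?split ?P1 \<union> ?split ?P2)))"
      proof (cases "\<kappa> v = \<kappa> w")
        case False
        then consider "\<exists>a\<in>elts y. \<kappa> a = \<kappa> v \<and> \<not> at_q w a" | "\<exists>a\<in>elts y. \<kappa> a = \<kappa> v \<and> \<not> at_p a w"
          using Rwv unfolding R_def by blast
        then show ?thesis
        proof cases
          case 1
          then have "v \<in> ?split (at_q w) \<or> v \<in> ?split ?P1"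
            using v split1 False by (cases "\<exists>a\<in>elts y. \<kappa> a = \<kappa> v \<and> at_q w a") auto
          then show ?thesis by blast
        next
          case 2
          then have "v \<in> ?split (\<lambda>a. at_p a w) \<or> v \<in> ?split ?P2"
            using v split2 False by (cases "\<exists>a\<in>elts y. \<kappa> a = \<kappa> v \<and> at_p a w") auto
          then show ?thesis by blast
        qed
      qed (use v in blast)
    qed
    moreover have "small {v. v \<in> elts y \<and> R w v}"
      unfolding R_def by (rule small_sep) (intro dfns definable_at_q definable_at_p)
    ultimately show "internally_finite {v. v \<in> elts y \<and> R w v}" by (rule internally_finite_subset)
  qed
qed

end

section \<open>Choosing six elements\<close>

context ZF
begin

lemma internally_finite_finite_UN: "finite I \<Longrightarrow> (\<And>i. i \<in> I \<Longrightarrow> internally_finite (Q i)) \<Longrightarrow> internally_finite (\<Union>i\<in>I. Q i)"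
  by (induction I rule: finite_induct) (auto intro: internally_finite_Un)

end

context homogeneous
begin

text \<open>There are only finitely many standard index sets \<open>J\<close> and pairs i, j. If
  each outcome occurred in finitely many classes, these together with the finitely many split
  classes would exhaust \<open>y\<close>; so one \<open>J\<close> serves infinitely many
  classes.\<close>

lemma six_selection_of_images:
  assumes k6: "k \<le> 6" and \<rho>: "\<And>i. definable_fun (\<rho> i)"
    and inj: "\<And>w. w \<in> elts y \<Longrightarrow> inj_on (\<lambda>i. \<rho> i w) {..<7::nat}"
  shows "\<exists>J\<subseteq>{..<7}. \<exists>S. elts S \<subseteq> elts y \<and> \<not> is_finite S \<and>
    (\<forall>w\<in>elts S. has_card (\<Union>i\<in>J. \<rho> i ` {v. v \<in> elts y \<and> \<kappa> v = \<kappa> w}) 6)"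
proof (rule ccontr)
  assume none: "\<not> ?thesis"
  note dfns = definable_intros term_kappa term_app1[OF \<rho>]
  let ?C = "\<lambda>w. {v. v \<in> elts y \<and> \<kappa> v = \<kappa> w}"
  have "elts y \<noteq> {}" using infinite_y internally_finite_elts[of y] internally_finite_empty by metis
  then obtain w0 where "w0 \<in> elts y" by blast
  then have "k \<noteq> 0" using card_class[of w0] by (metis (mono_tags, lifting) card_0_eq empty_iff mem_Collect_eq)
  then have k: "k \<in> {1, 2, 3, 6}" using k6 class_size_not_4_5 by (cases "k = 4 \<or> k = 5") auto
  \<comment> \<open>A class not split by any \<open>P i c\<close> has constant fibre sizes for
    coordinate \<open>i\<close>; one not split by any \<open>Q i j\<close> has pairwise equal or
    disjoint images.\<close>
  define P where "P i c w \<longleftrightarrow> has_card (?C w \<inter> {v. \<rho> i v = \<rho> i w}) c" for i c w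
  define Q where "Q i j w \<longleftrightarrow> (\<exists>v\<in>elts y. \<kappa> v = \<kappa> w \<and> \<rho> i w = \<rho> j v)" for i j w
  have definable_P: "definable (\<lambda>e. P i c (t e))" if "definable_term t" for i c t
  proof (rule definable_lift1[OF _ that])
    have "{v. v \<in> elts y \<and> \<kappa> v = \<kappa> w} \<inter> {v. \<rho> i v = \<rho> i w} =
        elts (the_elt_of {v. v \<in> elts y \<and> \<kappa> v = \<kappa> w \<and> \<rho> i v = \<rho> i w})" for w
      by (subst elts_sep) (auto intro!: dfns)
    then show "definable (\<lambda>e. P i c (e j))" for j unfolding P_def by (simp only:) (intro dfns)
  qed
  have definable_Q: "definable (\<lambda>e. Q i j (t e))" if "definable_term t" for i j t
    by (rule definable_lift1[OF _ that]) (unfold Q_def, intro dfns)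
  let ?split = "\<lambda>P. {w. w \<in> elts y \<and> (\<exists>v\<in>elts y. \<kappa> v = \<kappa> w \<and> P v) \<and> (\<exists>v\<in>elts y. \<kappa> v = \<kappa> w \<and> \<not> P v)}"
  define bad where "bad = (\<Union>i\<in>{..<7}. (\<Union>c\<in>{..6}. ?split (P i c)) \<union> (\<Union>j\<in>{..<7}. ?split (Q i j)))"
  have "internally_finite bad" unfolding bad_def
    by (intro internally_finite_finite_UN internally_finite_Un split_internally_finite definable_P definable_Q dfns) auto
  define S where "S J = {w. w \<in> elts y \<and> has_card (\<Union>i\<in>J. \<rho> i ` ?C w) 6}" for J
  have "internally_finite (S J)" if "J \<in> Pow {..<7}" for J
  proof -
    define U where "U w = the_elt_of {a. \<exists>v\<in>elts y. \<kappa> v = \<kappa> w \<and> (\<exists>i\<in>J. a = \<rho> i v)}" for w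
    have finJ: "finite J" using that finite_subset by auto
    have U: "elts (U w) = (\<Union>i\<in>J. \<rho> i ` ?C w)" if "w \<in> elts y" for w
    proof -
      have "{a. \<exists>v\<in>elts y. \<kappa> v = \<kappa> w \<and> (\<exists>i\<in>J. a = \<rho> i v)} = (\<Union>i\<in>J. \<rho> i ` ?C w)" by auto
      moreover have "finite (\<Union>i\<in>J. \<rho> i ` ?C w)" using finJ card_class[OF that] by blast
      ultimately show ?thesis unfolding U_def by (simp add: elts_the_elt_of small_finite)
    qed
    have "S J = {w. w \<in> elts y \<and> has_card (elts (U w)) 6}" unfolding S_def using U by auto
    moreover have "small {w. w \<in> elts y \<and> has_card (elts (U w)) 6}"
      unfolding U_def by (rule small_sep) (intro dfns definable_bex_finite finJ)
    ultimately obtain s where s: "S J = elts s" by (metis smallE)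
    then have "elts s \<subseteq> elts y" "\<forall>w\<in>elts s. has_card (\<Union>i\<in>J. \<rho> i ` ?C w) 6"
      unfolding S_def by blast+
    then have "is_finite s" using none that by blast
    then show ?thesis using s by simp
  qed
  then have fin_S: "internally_finite (\<Union>J\<in>Pow {..<7}. S J)" by (intro internally_finite_finite_UN) auto
  define T where "T i j = {w. w \<in> elts y \<and> k = 6 \<and> (\<forall>v\<in>elts y. \<kappa> v = \<kappa> w \<longrightarrow> P i 2 v \<and> P j 3 v)}" for i j
  have "internally_finite (T i j)" for i j
  proof (rule ccontr)
    assume inf: "\<not> internally_finite (T i j)"
    have "small (T i j)" unfolding T_def by (rule small_sep) (intro dfns definable_P)
    then obtain t where t: "T i j = elts t" by (rule smallE)
    have t_inf: "\<not> is_finite t" using inf t by simp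
    then have "elts t \<noteq> {}" using internally_finite_elts[of t] internally_finite_empty by metis
    then have "k = 6" using t unfolding T_def by blast
    have t_sub: "elts t \<subseteq> elts y" using t unfolding T_def by blast
    have t_iff: "w \<in> elts t \<longleftrightarrow> w \<in> elts y \<and> k = 6 \<and> (\<forall>v\<in>elts y. \<kappa> v = \<kappa> w \<longrightarrow> P i 2 v \<and> P j 3 v)" for w
      unfolding t[symmetric] T_def by simp
    have t_sat: "v \<in> elts t" if "w \<in> elts t" "v \<in> elts y" "\<kappa> v = \<kappa> w" for w v
      using that unfolding t_iff by simp
    \<comment> \<open>The exceptional outcome is a property of whole classes, so an infinite set of
      such classes is homogeneous itself.\<close>
    interpret T: homogeneous mem \<kappa> \<phi> t k using t_sub t_inf t_sat by (rule homogeneous_subset)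
    have eq: "{v. v \<in> elts t \<and> \<kappa> v = \<kappa> w \<and> \<rho> l v = \<rho> l w} = ?C w \<inter> {v. \<rho> l v = \<rho> l w}"
      if "w \<in> elts t" for w l using t_sub t_sat that by auto
    have card: "P i 2 w \<and> P j 3 w" if "w \<in> elts t" for w
      using that unfolding t_iff by simp
    show False
    proof (rule T.no_fibers_2_3[OF \<open>k = 6\<close> \<rho> \<rho>])
      fix w assume w: "w \<in> elts t"
      show "card {v. v \<in> elts t \<and> \<kappa> v = \<kappa> w \<and> \<rho> i v = \<rho> i w} = 2"
        unfolding eq[OF w] using card[OF w] unfolding P_def has_card_def by blast
      show "card {v. v \<in> elts t \<and> \<kappa> v = \<kappa> w \<and> \<rho> j v = \<rho> j w} = 3"
        unfolding eq[OF w] using card[OF w] unfolding P_def has_card_def by blast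
    qed
  qed
  then have fin_T: "internally_finite (\<Union>i\<in>{..<7}. \<Union>j\<in>{..<7}. T i j)" by (intro internally_finite_finite_UN) auto
  have "elts y \<subseteq> bad \<union> ((\<Union>J\<in>Pow {..<7}. S J) \<union> (\<Union>i\<in>{..<7}. \<Union>j\<in>{..<7}. T i j))"
  proof
    fix w assume w: "w \<in> elts y"
    show "w \<in> bad \<union> ((\<Union>J\<in>Pow {..<7}. S J) \<union> (\<Union>i\<in>{..<7}. \<Union>j\<in>{..<7}. T i j))"
    proof (cases "w \<in> bad")
      case False
      note W = card_class[OF w]
      have fib_eq: "{x \<in> ?C w. \<rho> i x = \<rho> i u} = ?C u \<inter> {v. \<rho> i v = \<rho> i u}" if "u \<in> ?C w" for i u
        using that by auto
      have P_iff: "P i c u \<longleftrightarrow> card {x \<in> ?C w. \<rho> i x = \<rho> i u} = c" if "u \<in> ?C w" for i c u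
        unfolding P_def has_card_def fib_eq[OF that, symmetric]
        using finite_subset[of "{x \<in> ?C w. \<rho> i x = \<rho> i u}" "?C w"] W by auto
      have fib: "card {x \<in> ?C w. \<rho> i x = \<rho> i u} = card {x \<in> ?C w. \<rho> i x = \<rho> i v}"
        if i: "i < 7" and u: "u \<in> ?C w" and v: "v \<in> ?C w" for i u v
      proof (rule ccontr)
        define c where "c = card {x \<in> ?C w. \<rho> i x = \<rho> i u}"
        assume "card {x \<in> ?C w. \<rho> i x = \<rho> i u} \<noteq> card {x \<in> ?C w. \<rho> i x = \<rho> i v}"
        then have "P i c u" "\<not> P i c v" using P_iff[OF u] P_iff[OF v] c_def by auto
        then have "w \<in> ?split (P i c)" using u v w by blast
        moreover have "c \<le> card (?C w)" unfolding c_def using W by (intro card_mono) auto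
        then have "c \<le> 6" using W k6 by simp
        ultimately have "w \<in> bad" unfolding bad_def using i by blast
        then show False using False by simp
      qed
      have blk: "\<rho> i ` ?C w \<subseteq> \<rho> j ` ?C w \<or> \<rho> i ` ?C w \<inter> \<rho> j ` ?C w = {}" if ij: "i < 7" "j < 7" for i j
      proof (rule ccontr)
        assume "\<not> ?thesis"
        then obtain u v v' where u: "u \<in> ?C w" "\<rho> i u \<notin> \<rho> j ` ?C w"
          and v: "v \<in> ?C w" "v' \<in> ?C w" "\<rho> i v = \<rho> j v'" by blast
        have "\<not> Q i j u" "Q i j v" using u v unfolding Q_def by auto
        then have "w \<in> ?split (Q i j)" using u v w by blast
        then have "w \<in> bad" unfolding bad_def using ij by blast
        then show False using False by simp
      qed
      have "(\<exists>J\<subseteq>{..<7}. card (\<Union>i\<in>J. \<rho> i ` ?C w) = 6) \<or>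
        (card (?C w) = 6 \<and> (\<exists>i<7. \<exists>j<7. (\<forall>v\<in>?C w. card {x \<in> ?C w. \<rho> i x = \<rho> i v} = 2) \<and>
          (\<forall>v\<in>?C w. card {x \<in> ?C w. \<rho> j x = \<rho> j v} = 3)))"
      proof (rule six_from_blocks)
        show "finite (?C w)" "card (?C w) \<in> {1, 2, 3, 6}" using W k by auto
        show "w \<in> ?C w" using w by simp
        show "inj_on (\<lambda>i. \<rho> i w) {..<7}" by (rule inj[OF w])
      qed (fact fib blk)+
      then show ?thesis
      proof (elim disjE exE conjE)
        fix J :: "nat set" assume J: "J \<subseteq> {..<7}" "card (\<Union>i\<in>J. \<rho> i ` ?C w) = 6"
        then have "finite (\<Union>i\<in>J. \<rho> i ` ?C w)" by (metis card.infinite zero_neq_numeral)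
        then have "w \<in> S J" unfolding S_def has_card_def using J w by simp
        then show ?thesis using J by blast
      next
        fix i j :: nat
        assume ij: "i < 7" "j < 7" and "card (?C w) = 6"
          and "\<forall>v\<in>?C w. card {x \<in> ?C w. \<rho> i x = \<rho> i v} = 2" "\<forall>v\<in>?C w. card {x \<in> ?C w. \<rho> j x = \<rho> j v} = 3"
        then have "w \<in> T i j" unfolding T_def using w W P_iff by auto
        then show ?thesis using ij by blast
      qed
    qed simp
  qed
  moreover have "internally_finite (bad \<union> ((\<Union>J\<in>Pow {..<7}. S J) \<union> (\<Union>i\<in>{..<7}. \<Union>j\<in>{..<7}. T i j)))"
    by (intro internally_finite_Un \<open>internally_finite bad\<close> fin_S fin_T)
  ultimately have "internally_finite (elts y)" using internally_finite_subset small_elts by blast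
  then show False using infinite_y by simp
qed

end

context ZF
begin

section \<open>Finite products and tuples\<close>

definition cart_prod :: "'a \<Rightarrow> 'a \<Rightarrow> 'a" where
  "cart_prod A B = the_elt_of {u. \<exists>a\<in>elts A. \<exists>b\<in>elts B. u = kpair a b}"

lemma term_cart: "definable_term t \<Longrightarrow> definable_term s \<Longrightarrow> definable_term (\<lambda>e. cart_prod (t e) (s e))"
  by (rule term_lift2) (unfold cart_prod_def, intro definable_intros)

lemma cart_finite:
  assumes "is_finite A" "is_finite B"
  shows "elts (cart_prod A B) = {u. \<exists>a\<in>elts A. \<exists>b\<in>elts B. u = kpair a b}" "is_finite (cart_prod A B)"
proof -
  define g where "g a = the_elt_of {u. \<exists>b\<in>elts B. u = kpair a b}" for a
  have "internally_finite (kpair a ` elts B)" for a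
    using assms(2) by (intro internally_finite_image definable_funI definable_intros) simp
  moreover have "{u. \<exists>b\<in>elts B. u = kpair a b} = kpair a ` elts B" for a by auto
  ultimately have g: "elts (g a) = kpair a ` elts B" "internally_finite (elts (g a))" for a
    unfolding g_def using elts_the_elt_of internally_finite_small by metis+
  have "internally_finite (\<Union>a\<in>elts A. elts (g a))"
    by (rule internally_finite_UN) (use assms g(2) in \<open>auto simp: g_def intro!: definable_funI definable_intros\<close>)
  moreover have eq: "(\<Union>a\<in>elts A. elts (g a)) = {u. \<exists>a\<in>elts A. \<exists>b\<in>elts B. u = kpair a b}"
    unfolding g(1) by auto
  ultimately show "elts (cart_prod A B) = {u. \<exists>a\<in>elts A. \<exists>b\<in>elts B. u = kpair a b}"
    unfolding cart_prod_def using elts_the_elt_of internally_finite_small by metis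
  then show "is_finite (cart_prod A B)" using \<open>internally_finite (\<Union>a\<in>elts A. elts (g a))\<close> eq internally_finite_elts by metis
qed

text \<open>Nested pairs closed off by the dummy entry \<open>A\<close>. Length and positions are
  HOL numbers, so each fixed length gives one definable term.\<close>

primrec tuples :: "nat \<Rightarrow> 'a \<Rightarrow> 'a" where
  "tuples 0 A = upair A A"
| "tuples (Suc n) A = cart_prod A (tuples n A)"

primrec proj :: "nat \<Rightarrow> 'a \<Rightarrow> 'a" where
  "proj 0 w = fstp w"
| "proj (Suc i) w = proj i (sndp w)"

lemma term_tuples: "definable_term t \<Longrightarrow> definable_term (\<lambda>e. tuples n (t e))"
  by (induction n) (auto intro: definable_intros term_cart)

lemma term_proj: "definable_term t \<Longrightarrow> definable_term (\<lambda>e. proj i (t e))"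
  by (induction i arbitrary: t) (auto intro: definable_intros)

lemma is_finite_tuples: assumes "is_finite A" shows "is_finite (tuples n A)"
proof (induction n)
  case 0
  have "internally_finite (elts (upair A A))" by simp
  then show ?case by (simp del: elts_upair)
qed (simp add: cart_finite assms)

lemma proj_tuples:
  "is_finite A \<Longrightarrow> t \<in> elts (tuples n A) \<Longrightarrow> i < n \<Longrightarrow> proj i t \<in> elts A"
proof (induction n arbitrary: t i)
  case (Suc n)
  then obtain a b where "a \<in> elts A" "b \<in> elts (tuples n A)" "t = kpair a b"
    using cart_finite(1)[OF Suc.prems(1) is_finite_tuples[OF Suc.prems(1)]] by auto
  then show ?case using Suc by (cases i) auto
qed simp

text \<open>\<open>l\<close> may be an arbitrary HOL function: finitely many values at standard
  positions can always be assembled into an element of the model.\<close>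

lemma tuple_exists:
  "is_finite A \<Longrightarrow> (\<And>i. i < n \<Longrightarrow> l i \<in> elts A) \<Longrightarrow> \<exists>t\<in>elts (tuples n A). \<forall>i<n. proj i t = l i"
proof (induction n arbitrary: l)
  case (Suc n)
  have "\<exists>t\<in>elts (tuples n A). \<forall>i<n. proj i t = l (Suc i)"
    by (rule Suc.IH) (use Suc.prems in auto)
  then obtain t where t: "t \<in> elts (tuples n A)" "\<forall>i<n. proj i t = l (Suc i)" by blast
  have "kpair (l 0) t \<in> elts (tuples (Suc n) A)"
    using t Suc.prems cart_finite(1)[OF Suc.prems(1) is_finite_tuples[OF Suc.prems(1)]] by auto
  moreover have "\<forall>i<Suc n. proj i (kpair (l 0) t) = l i"
    using t by (auto simp: less_Suc_eq_0_disj)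
  ultimately show ?case by blast
qed simp

end

context six_selection
begin

lemma six_choice:
  assumes F: "\<not> is_finite F" and big: "\<And>A. A \<in> elts F \<Longrightarrow> is_finite A \<and> exceeds 6 (elts A)"
  shows "\<exists>B g. elts B \<subseteq> elts F \<and> \<not> is_finite B \<and> definable_fun g \<and>
        (\<forall>A\<in>elts B. elts (g A) \<subseteq> elts A \<and> has_card (elts (g A)) 6)"
proof -
  \<comment> \<open>The first entry records \<open>A\<close>, so tuples from overlapping members of
    the family fall into different classes of \<open>fstp\<close>.\<close>
  define G where "G A = cart_prod (upair A A) (tuples 7 A)" for A
  have term_G: "definable_term t \<Longrightarrow> definable_term (\<lambda>e. G (t e))" for t
    by (rule term_lift1) (unfold G_def, intro term_cart term_tuples definable_intros)
  have fin_single: "is_finite (upair A A)" for A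
    using internally_finite_elts[of "upair A A"] by (simp del: internally_finite_elts)
  have G: "elts (G A) = {u. \<exists>t\<in>elts (tuples 7 A). u = kpair A t}" "is_finite (G A)" if "A \<in> elts F" for A
    using cart_finite[OF fin_single[of A] is_finite_tuples[of A 7]] big[OF that] unfolding G_def by simp_all
  define \<rho> where "\<rho> i w = proj i (sndp w)" for i w
  have \<rho>: "definable_fun (\<rho> i)" for i unfolding \<rho>_def by (intro definable_funI term_proj definable_intros)
  have fst: "definable_fun fstp" by (intro definable_funI definable_intros)
  obtain X0 where X0: "elts X0 = (\<Union>A\<in>elts F. elts (G A))"
    using small_UN[OF small_elts[of F], of G] term_G[OF term_var] by (metis smallE)
  define X where "X = the_elt_of {w. w \<in> elts X0 \<and> (\<forall>i\<in>{..<7}. \<forall>j\<in>{..<7}. i \<noteq> j \<longrightarrow> \<rho> i w \<noteq> \<rho> j w)}"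
  have "elts X = {w. w \<in> elts X0 \<and> (\<forall>i\<in>{..<7}. \<forall>j\<in>{..<7}. i \<noteq> j \<longrightarrow> \<rho> i w \<noteq> \<rho> j w)}"
    unfolding X_def by (rule elts_sep) (intro definable_ball_finite definable_intros term_app1[OF \<rho>] finite_lessThan)
  then have X: "w \<in> elts X \<longleftrightarrow> (\<exists>A\<in>elts F. w \<in> elts (G A)) \<and> inj_on (\<lambda>i. \<rho> i w) {..<7}" for w
    unfolding X0 inj_on_def by blast
  have fst_G: "fstp w = A" if "A \<in> elts F" "w \<in> elts (G A)" for A w using that G(1) by auto
  have X_F: "fstp w \<in> elts F" if "w \<in> elts X" for w using that X fst_G by blast
  have X_\<rho>: "\<rho> i w \<in> elts (fstp w)" if w: "w \<in> elts X" and i: "i < 7" for i w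
  proof -
    obtain A where A: "A \<in> elts F" "w \<in> elts (G A)" using w X by blast
    then obtain t where "t \<in> elts (tuples 7 A)" "w = kpair A t" using G(1) by auto
    then show ?thesis using proj_tuples[of A t 7 i] big[OF A(1)] i unfolding \<rho>_def by simp
  qed
  have X_ex: "\<exists>w\<in>elts X. fstp w = A" if A: "A \<in> elts F" for A
  proof -
    \<comment> \<open>A member of nonstandard size is infinite in HOL, hence the second
      case.\<close>
    have "\<exists>T\<subseteq>elts A. finite T \<and> card T = 7"
    proof (cases "finite (elts A)")
      case True
      then have "7 \<le> card (elts A)" using big[OF A] unfolding exceeds_def by simp
      then show ?thesis by (metis obtain_subset_with_card_n)
    next
      case False
      then show ?thesis using infinite_arbitrarily_large[of "elts A" 7] by blast
    qed
    then obtain T where T: "T \<subseteq> elts A" "finite T" "card T = 7" by blast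
    obtain l where l: "bij_betw l {0..<7::nat} T" using ex_bij_betw_nat_finite[OF T(2)] T(3) by auto
    have "\<exists>t\<in>elts (tuples 7 A). \<forall>i<7. proj i t = l i"
    proof (rule tuple_exists)
      show "is_finite A" using big[OF A] by simp
      show "l i \<in> elts A" if "i < 7" for i using bij_betwE[OF l] T(1) that by auto
    qed
    then obtain t where t: "t \<in> elts (tuples 7 A)" "\<forall>i<7. proj i t = l i" by blast
    have "inj_on (\<lambda>i. \<rho> i (kpair A t)) {..<7}"
      using bij_betw_imp_inj_on[OF l] t(2) unfolding \<rho>_def inj_on_def by auto
    moreover have "kpair A t \<in> elts (G A)" using G(1)[OF A] t by auto
    ultimately have "kpair A t \<in> elts X" using X A by blast
    then show ?thesis by force
  qed
  have X_inf: "\<not> is_finite X"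
  proof
    assume "is_finite X"
    then have "internally_finite (fstp ` elts X)" using fst by (intro internally_finite_image) simp_all
    moreover have "fstp ` elts X = elts F" using X_F X_ex by force
    ultimately show False using F by simp
  qed
  have "is_finite (class_of fstp X w)" if w: "w \<in> elts X" for w
  proof (rule is_finite_subset)
    show "is_finite (G (fstp w))" using G(2) X_F[OF w] by simp
    show "elts (class_of fstp X w) \<subseteq> elts (G (fstp w))"
    proof
      fix v assume "v \<in> elts (class_of fstp X w)"
      then have v: "v \<in> elts X" "fstp v = fstp w" unfolding elts_class_of[OF fst] by auto
      then obtain A where "A \<in> elts F" "v \<in> elts (G A)" using X by blast
      then show "v \<in> elts (G (fstp w))" using fst_G v(2) by metis
    qed
  qed
  then obtain \<phi> y k where y: "elts y \<subseteq> elts X" "k \<le> 6" and hom: "homogeneous mem fstp \<phi> y k"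
    using homogeneous_exists[OF X_inf fst] by blast
  interpret H: homogeneous mem fstp \<phi> y k by (rule hom)
  have "\<exists>J\<subseteq>{..<7}. \<exists>S. elts S \<subseteq> elts y \<and> \<not> is_finite S \<and>
      (\<forall>w\<in>elts S. has_card (\<Union>i\<in>J. \<rho> i ` {v. v \<in> elts y \<and> fstp v = fstp w}) 6)"
    using y X by (intro H.six_selection_of_images \<rho>) blast+
  then obtain J S where J: "J \<subseteq> {..<7}" and S: "elts S \<subseteq> elts y" "\<not> is_finite S"
    and six: "\<And>w. w \<in> elts S \<Longrightarrow> has_card (\<Union>i\<in>J. \<rho> i ` {v. v \<in> elts y \<and> fstp v = fstp w}) 6"
    by blast
  have finJ: "finite J" using J finite_subset by blast
  have "small (fstp ` elts S)" by (rule small_image) (simp, intro definable_intros)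
  then obtain B where B: "fstp ` elts S = elts B" by (rule smallE)
  \<comment> \<open>The union runs over the whole class of \<open>A\<close> in \<open>y\<close>, so
    no tuple has to be chosen and the result depends on \<open>A\<close> alone.\<close>
  define g where "g A = the_elt_of {a. \<exists>v\<in>elts y. fstp v = A \<and> (\<exists>i\<in>J. a = \<rho> i v)}" for A
  have "definable_fun g" unfolding g_def by (intro definable_funI definable_intros definable_bex_finite finJ term_app1[OF \<rho>])
  moreover have "elts (g A) \<subseteq> elts A \<and> has_card (elts (g A)) 6" if "A \<in> elts B" for A
  proof -
    have "A \<in> fstp ` elts S" using that B by simp
    then obtain w where w: "w \<in> elts S" "fstp w = A" by blast
    have eq: "{a. \<exists>v\<in>elts y. fstp v = A \<and> (\<exists>i\<in>J. a = \<rho> i v)} =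
        (\<Union>i\<in>J. \<rho> i ` {v. v \<in> elts y \<and> fstp v = fstp w})" using w(2) by auto
    then have g: "elts (g A) = (\<Union>i\<in>J. \<rho> i ` {v. v \<in> elts y \<and> fstp v = fstp w})"
      unfolding g_def eq using six[OF w(1)] unfolding has_card_def by (intro elts_the_elt_of small_finite) blast
    have "\<rho> i v \<in> elts A" if "i \<in> J" "v \<in> elts y" "fstp v = A" for i v
      using X_\<rho>[of v i] that J y(1) by auto
    then have "elts (g A) \<subseteq> elts A" unfolding g using w(2) by auto
    then show ?thesis using six[OF w(1)] unfolding g by blast
  qed
  moreover have "elts B \<subseteq> elts F"
  proof -
    have "fstp ` elts S \<subseteq> elts F" using S(1) y(1) X_F by blast
    then show ?thesis using B by simp
  qed
  moreover have "\<not> is_finite B"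
  proof
    assume "is_finite B"
    \<comment> \<open>Over a finite \<open>B\<close>, the finite classes \<open>h A\<close> would
      cover \<open>S\<close>.\<close>
    define h where "h A = the_elt_of {v. v \<in> elts y \<and> fstp v = A}" for A
    have h: "elts (h A) = {v. v \<in> elts y \<and> fstp v = A}" for A
      unfolding h_def by (rule elts_sep) (intro definable_intros)
    have "internally_finite (\<Union>A\<in>elts B. elts (h A))"
    proof (rule internally_finite_UN)
      show "internally_finite (elts B)" using \<open>is_finite B\<close> by simp
      show "definable_fun h" unfolding h_def by (intro definable_funI definable_intros)
      fix A assume "A \<in> elts B"
      then have "A \<in> fstp ` elts S" using B by simp
      then show "internally_finite (elts (h A))" unfolding h using H.internally_finite_cls S(1) by auto
    qed
    moreover have "elts S \<subseteq> (\<Union>A\<in>elts B. elts (h A))" unfolding B[symmetric] h using S(1) by auto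
    ultimately have "internally_finite (elts S)" using internally_finite_subset small_elts by blast
    then show False using S by simp
  qed
  ultimately show ?thesis by blast
qed

end

theorem theorem6p3:
  fixes mem :: "'a \<Rightarrow> 'a \<Rightarrow> bool" and six :: 'a
  assumes "ZF mem"
    and "set_structure.is_numeral mem 6 six"
    and "set_structure.nRC_fin mem six"
  shows "set_structure.nC_minus_fin mem six"
proof -
  interpret ZF mem by fact
  interpret six_selection mem
    by unfold_locales (rule nRC_fin_selects[OF assms(2,3)])
  show ?thesis by (rule nC_minus_finI[OF assms(2) six_choice])
qed

end
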